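(* Consider the data-driven setting described in the context (with $F(0)=0$, the data generated by $(A_{\mathrm{true}},B_{\mathrm{true}})$ with noise satisfying the energy bound, and $\begin{bmatrix}\mathcal F\\ \mathcal G\mathcal U\end{bmatrix}$ of full row rank). Let $K:\mathbb R^n\to\mathbb R^m$ be a continuous function such that $K(0)=0$. The data $(\dot{\mathcal X},\mathcal X,\mathcal U)$ are informative for closed-loop stability with respect to $K$ if and only if there exist a radially unbounded $V\in\mathcal V$ and a function $\beta:\mathbb R^n\to\mathbb R$ such that for all $x\in\mathbb R^n\setminus\{0\}$, $\beta(x)>0$ and $$\begin{bmatrix} -L_{\bar s}^{\top}(x)N_{22}^{-1}N_{21}+L_s^{\top}(x)v_s-\beta(x) & (N|N_{22})^{\frac12}L_{\bar s}^{\top}(x)\\ (N|N_{22})^{\frac12}L_{\bar s}(x) & \left(L_{\bar s}^{\top}(x)N_{22}^{-1}N_{21}-L_s^{\top}(x)v_s\right)N_{22} \end{bmatrix}\ge 0,$$ where $$L(x)=\begin{bmatrix}-I_n\otimes F(x)\\ -I_n\otimes G(x)K(x)\end{bmatrix}\frac{\partial V}{\partial x}^{\top}(x).$$ If the latter conditions hold, then the origin of the closed-loop system $\dot x=AF(x)+BG(x)K(x)$ is globally asymptotically stable for all $(A,B)\in\Sigma$. Moreover, the data $(\dot{\mathcal X},\mathcal X,\mathcal U)$ are informative for stabilization.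
   Context: Notation. $\mathbb S^k$: real symmetric $k\times k$ matrices; $>0,\ge 0,<0,\le 0$ for symmetric matrices denote (semi)definiteness. $\mathbb R^{p\times q}[x]$: $p\times q$ matrices of real polynomials in $x=(x_1,\dots,x_n)$; $\mathbb R^p[x]=\mathbb R^{p\times 1}[x]$, $\mathbb R[x]=\mathbb R^{1\times 1}[x]$. $\mathcal V=\{V\in\mathbb R[x]\mid V(0)=0,\ V(x)>0\ \forall x\in\mathbb R^n\setminus\{0\}\}$. $\frac{\partial V}{\partial x}$ is the row vector of partial derivatives. For a vector $v$ and index set $\sigma$, $v_\sigma$ is the subvector with entries indexed by $\sigma$; for a matrix $M$, $M_{\sigma\bullet}$ is the submatrix of rows indexed by $\sigma$. $\mathrm{vec}$ stacks the columns of a matrix; $\otimes$ is the Kronecker product. Setting. $F\in\mathbb R^f[x]$ with $F(0)=0$ and $G\in\mathbb R^{g\times m}[x]$ are given. The true system is $\dot x=A_{\mathrm{true}}F(x)+B_{\mathrm{true}}G(x)u+w$ with $A_{\mathrm{true}}\in\mathbb R^{n\times f}$, $B_{\mathrm{true}}\in\mathbb R^{n\times g}$. For sample times $t_0<\dots<t_{T-1}$ put $\dot{\mathcal X}=[\dot x(t_0)\cdots\dot x(t_{T-1})]$, $\mathcal X=[x(t_0)\cdots x(t_{T-1})]$, $\mathcal F=[F(x(t_0))\cdots F(x(t_{T-1}))]$, $\mathcal G=[G(x(t_0))\cdots G(x(t_{T-1}))]$, $\mathcal U=\mathrm{blockdiag}(u(t_0),\dots,u(t_{T-1}))\in\mathbb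 R^{mT\times T}$, $\mathcal W=[w(t_0)\cdots w(t_{T-1})]$. The data satisfy $\dot{\mathcal X}=A_{\mathrm{true}}\mathcal F+B_{\mathrm{true}}\mathcal G\mathcal U+\mathcal W$, where the unknown $\mathcal W\in\mathbb R^{n\times T}$ satisfies the noise bound $$\begin{bmatrix}1\\ \mathrm{vec}(\mathcal W^\top)\end{bmatrix}^\top\Phi\begin{bmatrix}1\\ \mathrm{vec}(\mathcal W^\top)\end{bmatrix}\ge 0,\qquad \Phi=\begin{bmatrix}\Phi_{11}&0\\0&-I\end{bmatrix},$$ with given $\Phi_{11}\ge 0$. Standing assumption: $\begin{bmatrix}\mathcal F\\ \mathcal G\mathcal U\end{bmatrix}$ has full row rank. $\Sigma_d$ is the set of $(A,B)\in\mathbb R^{n\times f}\times\mathbb R^{n\times g}$ such that $\dot{\mathcal X}=A\mathcal F+B\mathcal G\mathcal U+\mathcal W$ for some $\mathcal W$ satisfying the noise bound. For a given $S\subseteq\{1,\dots,n\}\times\{1,\dots,f+g\}$ (entries known a priori), $\Sigma_{pk}(S)$ is the set of $(A,B)$ with $[A\ B]_{ij}=[A_{\mathrm{true}}\ B_{\mathrm{true}}]_{ij}$ for all $(i,j)\in S$. $\Sigma:=\Sigma_d\cap\Sigma_{pk}(S)$. Put $\mathcal D=\begin{bmatrix}I_n\otimes\mathcal F\\ I_n\otimes\mathcal G\mathcal U\end{bmatrix}$ and, for $(A,B)$, $v=\begin{bmatrix}\mathrm{vec}(A^\top)\\ \mathrm{vec}(B^\top)\end{bmatrix}\in\mathbb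 R^{n(f+g)}$. Let $s$ be the set of indices of entries of $v$ that are known (those corresponding to entries in $S$), $\bar s=\{1,\dots,n(f+g)\}\setminus s$, $\ell=|\bar s|$; $v_s$ denotes the known vector of values from $(A_{\mathrm{true}},B_{\mathrm{true}})$. Define $$N=\begin{bmatrix}1&0\\ \mathrm{vec}(\dot{\mathcal X}^\top)-\mathcal D_{s\bullet}^\top v_s&-\mathcal D_{\bar s\bullet}^\top\end{bmatrix}^\top\Phi\begin{bmatrix}1&0\\ \mathrm{vec}(\dot{\mathcal X}^\top)-\mathcal D_{s\bullet}^\top v_s&-\mathcal D_{\bar s\bullet}^\top\end{bmatrix}\in\mathbb S^{1+\ell},$$ partitioned as $N=\begin{bmatrix}N_{11}&N_{12}\\N_{21}&N_{22}\end{bmatrix}$ with $N_{11}\in\mathbb R$, and $N|N_{22}=N_{11}-N_{12}N_{22}^{-1}N_{21}\in\mathbb R$. In this setting $N_{22}<0$ and $N|N_{22}\ge 0$, so the inverse and square root are well defined. Definitions. For continuous $K$ with $K(0)=0$, the data are informative for closed-loop stability with respect to $K$ if there exists a radially unbounded $V\in\mathcal V$ such that for all $(A,B)\in\Sigma$, $\frac{\partial V(x)}{\partial x}\left(AF(x)+BG(x)K(x)\right)<0$ for all $x\in\mathbb R^n\setminus\{0\}$. The data are informative for stabilization if there exist a radially unbounded $V\in\mathcal V$ and a continuous $K:\mathbb R^n\to\mathbb R^m$ with $K(0)=0$ such that this inequality holds for all $x\in\mathbb R^n\setminus\{0\}$ and all $(A,B)\in\Sigma$. *)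

theory Defs
  imports "HOL-Analysis.Analysis"
begin

subsection \<open>Block matrices, vectorization, Kronecker product\<close>

text \<open>A product index type is read lexicographically and a sum index type left part first. Stacking
  is polymorphic: it applies to vectors and, a matrix being a vector of rows, to matrices.\<close>

definition vcat :: "'a^'p \<Rightarrow> 'a^'q \<Rightarrow> 'a^('p::finite + 'q::finite)" where
  "vcat a b = (\<chi> i. case i of Inl p \<Rightarrow> a $ p | Inr q \<Rightarrow> b $ q)"

definition hcat :: "'a^'p^'r \<Rightarrow> 'a^'q^'r \<Rightarrow> 'a^('p::finite + 'q::finite)^'r::finite" where
  "hcat A B = (\<chi> i. vcat (A $ i) (B $ i))"

definition block ::
    "'a^'c^'r \<Rightarrow> 'a^'d^'r \<Rightarrow> 'a^'c^'q \<Rightarrow> 'a^'d^'q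
      \<Rightarrow> 'a^('c::finite + 'd::finite)^('r::finite + 'q::finite)" where
  "block A B C D = vcat (hcat A B) (hcat C D)"

text \<open>Stacking columns: the column index is the major one.\<close>

definition vectorize :: "'a^'c^'r \<Rightarrow> 'a^('c::finite \<times> 'r::finite)" where
  "vectorize M = (\<chi> p. M $ snd p $ fst p)"

definition kron ::
    "real^'q^'p \<Rightarrow> real^'s^'r \<Rightarrow> real^('q::finite \<times> 's::finite)^('p::finite \<times> 'r::finite)" where
  "kron A B = (\<chi> a b. A $ fst a $ fst b * B $ snd a $ snd b)"

definition pos_semidef :: "real^'k^'k::finite \<Rightarrow> bool" where
  "pos_semidef M \<longleftrightarrow> transpose M = M \<and> (\<forall>z. 0 \<le> z \<bullet> (M *v z))"

subsection \<open>Subvectors and submatrices\<close>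

text \<open>The index set \<open>\<sigma>\<close> of a subvector is a variable (and may be empty), so it cannot be a type.
  We identify the vectors indexed by \<open>\<sigma>\<close> with the vectors over the full index type that vanish
  outside \<open>\<sigma>\<close>, and treat matrices likewise. Sums, products, inner products and
  semidefiniteness are unaffected by this zero filling. The inverse is affected: it has to be
  taken among the matrices supported on \<open>\<sigma> \<times> \<sigma>\<close>, whose unit is \<open>id_on \<sigma>\<close>.\<close>

definition sel :: "'i set \<Rightarrow> 'a::zero^'i \<Rightarrow> 'a^'i::finite" where
  "sel \<sigma> v = (\<chi> i. if i \<in> \<sigma> then v $ i else 0)"

definition id_on :: "'i set \<Rightarrow> real^'i^'i::finite" where
  "id_on \<sigma> = sel \<sigma> (mat 1)"

definition inv_on :: "'i set \<Rightarrow> real^'i^'i \<Rightarrow> real^'i^'i::finite" where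
  "inv_on \<sigma> M = (THE R. (\<forall>i j. i \<notin> \<sigma> \<or> j \<notin> \<sigma> \<longrightarrow> R $ i $ j = 0)
                      \<and> M ** R = id_on \<sigma> \<and> R ** M = id_on \<sigma>)"

subsection \<open>Lyapunov functions and stability\<close>

definition gradient :: "(real^'n \<Rightarrow> real) \<Rightarrow> real^'n \<Rightarrow> real^'n::finite" where
  "gradient V x = (\<chi> i. deriv (\<lambda>h. V (x + h *\<^sub>R axis i 1)) 0)"

definition posdef_polys :: "(real^'n::finite \<Rightarrow> real) set" where
  "posdef_polys = {V. real_polynomial_function V \<and> V 0 = 0 \<and> (\<forall>x. x \<noteq> 0 \<longrightarrow> V x > 0)}"

definition radially_unbounded :: "(real^'n::finite \<Rightarrow> real) \<Rightarrow> bool" where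
  "radially_unbounded V \<longleftrightarrow> filterlim V at_top at_infinity"

definition closed_loop ::
    "(real^'n \<Rightarrow> real^'f) \<Rightarrow> (real^'n \<Rightarrow> real^'m^'g) \<Rightarrow> (real^'n \<Rightarrow> real^'m)
      \<Rightarrow> real^'f^'n \<Rightarrow> real^'g^'n \<Rightarrow> real^'n \<Rightarrow> real^'n" where
  "closed_loop F G K A B x = A *v F x + B *v (G x *v K x)"

definition solves_on :: "(real^'n \<Rightarrow> real^'n) \<Rightarrow> real set \<Rightarrow> (real \<Rightarrow> real^'n::finite) \<Rightarrow> bool" where
  "solves_on h J \<phi> \<longleftrightarrow> (\<forall>t\<in>J. (\<phi> has_vector_derivative h (\<phi> t)) (at t within J))"

text \<open>The vector field need not be locally Lipschitz, so solutions need not be unique. All of them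
  are required to behave well; in particular every solution extends to all nonnegative times, which
  excludes finite escape.\<close>

definition globally_asymptotically_stable :: "(real^'n \<Rightarrow> real^'n::finite) \<Rightarrow> bool" where
  "globally_asymptotically_stable h \<longleftrightarrow>
     h 0 = 0
   \<and> (\<forall>\<epsilon>>0. \<exists>\<delta>>0. \<forall>\<tau>>0. \<forall>\<phi>. solves_on h {0..<\<tau>} \<phi> \<and> norm (\<phi> 0) < \<delta>
        \<longrightarrow> (\<forall>t\<in>{0..<\<tau>}. norm (\<phi> t) < \<epsilon>))
   \<and> (\<forall>\<xi>. \<exists>\<phi>. solves_on h {0..} \<phi> \<and> \<phi> 0 = \<xi>)
   \<and> (\<forall>\<tau>>0. \<forall>\<phi>. solves_on h {0..<\<tau>} \<phi>
        \<longrightarrow> (\<exists>\<psi>. solves_on h {0..} \<psi> \<and> (\<forall>t\<in>{0..<\<tau>}. \<psi> t = \<phi> t)))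
   \<and> (\<forall>\<phi>. solves_on h {0..} \<phi> \<longrightarrow> (\<phi> \<longlongrightarrow> 0) at_top)"

subsection \<open>Data\<close>

definition samples :: "(real \<Rightarrow> real^'k) \<Rightarrow> ('t \<Rightarrow> real) \<Rightarrow> real^'t::finite^'k::finite" where
  "samples y \<tau> = (\<chi> i k. y (\<tau> k) $ i)"

definition input_data :: "(real \<Rightarrow> real^'m) \<Rightarrow> ('t \<Rightarrow> real) \<Rightarrow> real^'t::finite^('t \<times> 'm::finite)" where
  "input_data u \<tau> = (\<chi> p l. if fst p = l then u (\<tau> l) $ snd p else 0)"

definition F_data :: "(real^'n \<Rightarrow> real^'f) \<Rightarrow> real^'t^'n \<Rightarrow> real^'t::finite^'f::finite" where
  "F_data F X = (\<chi> i k. F (column k X) $ i)"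

definition G_data ::
    "(real^'n \<Rightarrow> real^'m^'g) \<Rightarrow> real^'t^'n \<Rightarrow> real^('t::finite \<times> 'm::finite)^'g::finite" where
  "G_data G X = (\<chi> i p. G (column (fst p) X) $ i $ snd p)"

definition noise_matrix :: "real \<Rightarrow> real^(1 + 'p)^(1 + 'p::finite)" where
  "noise_matrix \<Phi>11 = block (mat \<Phi>11) 0 0 (- mat 1)"

definition noise_bound :: "real \<Rightarrow> real^'t::finite^'n::finite \<Rightarrow> bool" where
  "noise_bound \<Phi>11 W \<longleftrightarrow>
     (let z = vcat (vec 1) (vectorize (transpose W)) in 0 \<le> z \<bullet> (noise_matrix \<Phi>11 *v z))"

definition Sigma_d ::
    "(real^'n \<Rightarrow> real^'f) \<Rightarrow> (real^'n \<Rightarrow> real^'m^'g)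
      \<Rightarrow> real^'t^'n \<Rightarrow> real^'t^'n \<Rightarrow> real^'t^('t \<times> 'm) \<Rightarrow> real
      \<Rightarrow> ((real^'f::finite^'n::finite) \<times> (real^'g::finite^'n)) set" where
  "Sigma_d F G Xd X U \<Phi>11 =
     {(A, B). \<exists>W. Xd = A ** F_data F X + B ** G_data G X ** U + W \<and> noise_bound \<Phi>11 W}"

definition Sigma_pk ::
    "real^'f^'n \<Rightarrow> real^'g^'n \<Rightarrow> ('n \<times> ('f + 'g)) set
      \<Rightarrow> ((real^'f::finite^'n::finite) \<times> (real^'g::finite^'n)) set" where
  "Sigma_pk A0 B0 S = {(A, B). \<forall>(i, j)\<in>S. hcat A B $ i $ j = hcat A0 B0 $ i $ j}"

definition informative_for_stability ::
    "(real^'n \<Rightarrow> real^'f) \<Rightarrow> (real^'n \<Rightarrow> real^'m^'g)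
      \<Rightarrow> ((real^'f::finite^'n::finite) \<times> (real^'g::finite^'n)) set
      \<Rightarrow> (real^'n \<Rightarrow> real^'m::finite) \<Rightarrow> bool" where
  "informative_for_stability F G \<Sigma> K \<longleftrightarrow>
     (\<exists>V\<in>posdef_polys. radially_unbounded V \<and>
        (\<forall>(A, B)\<in>\<Sigma>. \<forall>x. x \<noteq> 0 \<longrightarrow> gradient V x \<bullet> closed_loop F G K A B x < 0))"

definition informative_for_stabilization ::
    "(real^'n \<Rightarrow> real^'f) \<Rightarrow> (real^'n \<Rightarrow> real^'m::finite^'g)
      \<Rightarrow> ((real^'f::finite^'n::finite) \<times> (real^'g::finite^'n)) set \<Rightarrow> bool" where
  "informative_for_stabilization F G \<Sigma> \<longleftrightarrow>
     (\<exists>V\<in>posdef_polys. \<exists>K. radially_unbounded V \<and> continuous_on UNIV K \<and> K 0 = 0 \<and>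
        (\<forall>(A, B)\<in>\<Sigma>. \<forall>x. x \<noteq> 0 \<longrightarrow> gradient V x \<bullet> closed_loop F G K A B x < 0))"

subsection \<open>The matrix \<open>N\<close>\<close>

definition param_vec ::
    "real^'f^'n \<Rightarrow> real^'g^'n \<Rightarrow> real^(('n::finite \<times> 'f::finite) + ('n \<times> 'g::finite))" where
  "param_vec A B = vcat (vectorize (transpose A)) (vectorize (transpose B))"

definition known_idx :: "('n \<times> ('f + 'g)) set \<Rightarrow> (('n \<times> 'f) + ('n \<times> 'g)) set" where
  "known_idx S = {Inl (i, j) | i j. (i, Inl j) \<in> S} \<union> {Inr (i, j) | i j. (i, Inr j) \<in> S}"

definition data_matrix ::
    "(real^'n \<Rightarrow> real^'f) \<Rightarrow> (real^'n \<Rightarrow> real^'m^'g)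
      \<Rightarrow> real^'t^'n \<Rightarrow> real^'t^('t \<times> 'm::finite)
      \<Rightarrow> real^('n::finite \<times> 't::finite)^(('n \<times> 'f::finite) + ('n \<times> 'g::finite))" where
  "data_matrix F G X U =
     vcat (kron (mat 1) (F_data F X)) (kron (mat 1) (G_data G X ** U))"

text \<open>In \<open>N_matrix \<Phi>11 Xd D s v\<close>, \<open>s\<close> is the set of known indices; only the entries of \<open>v\<close> in
  \<open>s\<close> are used.\<close>

definition N_matrix ::
    "real \<Rightarrow> real^'t^'n \<Rightarrow> real^('n::finite \<times> 't::finite)^'i \<Rightarrow> 'i set \<Rightarrow> real^'i
      \<Rightarrow> real^(1 + 'i)^(1 + 'i::finite)" where
  "N_matrix \<Phi>11 Xd D s v =
     (let M = block (mat 1) 0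
                (columnvector (vectorize (transpose Xd) - transpose (sel s D) *v sel s v))
                (- transpose (sel (- s) D))
      in transpose M ** noise_matrix \<Phi>11 ** M)"

definition blk11 :: "real^(1 + 'i)^(1 + 'i::finite) \<Rightarrow> real" where
  "blk11 N = N $ Inl 1 $ Inl 1"

definition blk12 :: "real^(1 + 'i)^(1 + 'i) \<Rightarrow> real^'i::finite" where
  "blk12 N = (\<chi> j. N $ Inl 1 $ Inr j)"

definition blk21 :: "real^(1 + 'i)^(1 + 'i) \<Rightarrow> real^'i::finite" where
  "blk21 N = (\<chi> i. N $ Inr i $ Inl 1)"

definition blk22 :: "real^(1 + 'i)^(1 + 'i) \<Rightarrow> real^'i^'i::finite" where
  "blk22 N = (\<chi> i j. N $ Inr i $ Inr j)"

definition schur_compl :: "'i set \<Rightarrow> real^(1 + 'i)^(1 + 'i::finite) \<Rightarrow> real" where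
  "schur_compl \<sigma> N = blk11 N - blk12 N \<bullet> (inv_on \<sigma> (blk22 N) *v blk21 N)"

text \<open>The columns of \<open>I \<otimes> F x\<close> are indexed by \<open>'n \<times> 1\<close>, hence the reindexing of the gradient.\<close>

definition L_vec ::
    "(real^'n \<Rightarrow> real^'f) \<Rightarrow> (real^'n \<Rightarrow> real^'m^'g) \<Rightarrow> (real^'n \<Rightarrow> real^'m::finite)
      \<Rightarrow> (real^'n \<Rightarrow> real) \<Rightarrow> real^'n
      \<Rightarrow> real^(('n::finite \<times> 'f::finite) + ('n \<times> 'g::finite))" where
  "L_vec F G K V x =
     vcat (- kron (mat 1) (columnvector (F x))) (- kron (mat 1) (columnvector (G x *v K x)))
       *v (\<chi> p::'n \<times> 1. gradient V x $ fst p)"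

text \<open>The matrix of the inequality, for \<open>l = L x\<close>, \<open>b = \<beta> x\<close> and the set \<open>s\<close> of known indices.\<close>

definition LMI_matrix ::
    "real^(1 + 'i)^(1 + 'i) \<Rightarrow> 'i set \<Rightarrow> real^'i \<Rightarrow> real^'i \<Rightarrow> real
      \<Rightarrow> real^(1 + 'i)^(1 + 'i::finite)" where
  "LMI_matrix N s v l b =
     (let \<gamma> = sel (- s) l \<bullet> (inv_on (- s) (blk22 N) *v blk21 N);
          \<kappa> = sel s l \<bullet> sel s v;
          r = sqrt (schur_compl (- s) N)
      in block (mat (- \<gamma> + \<kappa> - b)) (rowvector (r *\<^sub>R sel (- s) l))
               (columnvector (r *\<^sub>R sel (- s) l)) ((\<gamma> - \<kappa>) *\<^sub>R blk22 N))"

definition LMI_condition ::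
    "(real^'n \<Rightarrow> real^'f) \<Rightarrow> (real^'n \<Rightarrow> real^'m^'g) \<Rightarrow> (real^'n \<Rightarrow> real^'m::finite)
      \<Rightarrow> real^(1 + (('n \<times> 'f) + ('n \<times> 'g)))^(1 + (('n \<times> 'f) + ('n \<times> 'g)))
      \<Rightarrow> (('n \<times> 'f) + ('n \<times> 'g)) set
      \<Rightarrow> real^(('n::finite \<times> 'f::finite) + ('n \<times> 'g::finite)) \<Rightarrow> bool" where
  "LMI_condition F G K N s v \<longleftrightarrow>
     (\<exists>V\<in>posdef_polys. \<exists>\<beta>. radially_unbounded V \<and>
        (\<forall>x. x \<noteq> 0 \<longrightarrow> \<beta> x > 0 \<and> pos_semidef (LMI_matrix N s v (L_vec F G K V x) (\<beta> x))))"

end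

theory Submission
  imports Defs "HOL-Complex_Analysis.Great_Picard"
begin

text \<open>Completing the square around the least squares estimate shows that the unknown parameters
  consistent with the data and the prior knowledge form an ellipsoid whose squared radius is the
  Schur complement \<open>N|N22\<close>. The derivative of \<open>V\<close> along the closed loop is, up to sign, linear in the
  parameters with coefficient vector \<open>L x\<close>, so for each \<open>x\<close> negativity for all consistent systems
  means that the minimum of a linear function over this ellipsoid is positive. By Cauchy-Schwarz that
  minimum is explicit, and its positivity is the matrix inequality for a suitable \<open>\<beta> x\<close>.

  For stability the closed loop is merely continuous, so existence of solutions is Peano's theorem:
  solutions of the equation with delay \<open>d\<close> are constructed directly, are equi-Lipschitz for a bounded
  field, and converge along a subsequence \<open>d \<longlonglongrightarrow> 0\<close>. Lyapunov's direct method then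
  gives boundedness, extendability and convergence of every solution.\<close>

subsection \<open>Peano's existence theorem\<close>

lemma integral_from_0_lipschitz:
  fixes f :: "real \<Rightarrow> 'a::euclidean_space"
  assumes f: "continuous_on UNIV f" and M: "\<And>s. norm (f s) \<le> M"
  shows "norm (integral {0..t} f - integral {0..s} f) \<le> M * \<bar>t - s\<bar>"
proof -
  have M0: "0 \<le> M" using M[of 0] norm_ge_zero order_trans by blast
  have int: "f integrable_on {a..b}" for a b
    using f by (intro integrable_continuous_real) (auto intro: continuous_on_subset)
  have neg: "integral {0..s} f = 0" if "s \<le> 0" for s :: real
    using that by (cases "s = 0") auto
  have bd: "norm (integral {a..b} f) \<le> M * (b - a)" if "a \<le> b" for a b :: real
    using has_integral_bound_real[OF M0 finite.emptyI integrable_integral[OF int[of a b]]] M that by auto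
  have le: "norm (integral {0..t} f - integral {0..s} f) \<le> M * (t - s)" if "s \<le> t" for s t :: real
  proof (cases "0 \<le> s")
    case True
    have "integral {0..t} f - integral {0..s} f = integral {s..t} f"
      using Henstock_Kurzweil_Integration.integral_combine[OF True that int] by (simp add: algebra_simps)
    then show ?thesis using bd[OF that] by simp
  next
    case False
    show ?thesis
    proof (cases "0 \<le> t")
      case True
      have "M * t \<le> M * (t - s)" using M0 False by (intro mult_left_mono) auto
      then show ?thesis using bd[OF True] neg[of s] False by simp
    next
      case f: False
      then show ?thesis using neg[of s] neg[of t] False M0 that by simp
    qed
  qed
  show ?thesis
  proof (cases "s \<le> t")
    case True
    then show ?thesis using le by simp
  next
    case False
    then show ?thesis using le[of t s] by (simp add: norm_minus_commute)
  qed
qed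

lemma lipschitz_bound_imp_continuous:
  fixes f :: "real \<Rightarrow> 'a::real_normed_vector"
  assumes "\<And>s t. norm (f t - f s) \<le> M * \<bar>t - s\<bar>"
  shows "continuous_on UNIV f"
proof -
  have "0 \<le> M" using order_trans[OF norm_ge_zero assms[of 1 0]] by simp
  then have "M-lipschitz_on UNIV f"
    using assms by (auto intro!: lipschitz_onI simp: dist_norm dist_real_def)
  then show ?thesis by (rule lipschitz_on_continuous_on)
qed

text \<open>The delay makes the integral equation explicit, so it is solved by stepping along
  intervals of length \<open>d\<close>.\<close>

lemma delayed_integral_equation:
  fixes h :: "'a::euclidean_space \<Rightarrow> 'a"
  assumes h: "continuous_on UNIV h" and M: "\<And>y. norm (h y) \<le> M" and d: "d > 0"
  obtains \<phi> where "\<And>t. \<phi> t = \<xi> + integral {0..t} (\<lambda>s. h (\<phi> (s - d)))"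
    and "\<And>s t. norm (\<phi> t - \<phi> s) \<le> M * \<bar>t - s\<bar>"
proof -
  \<comment> \<open>Picard iteration started from the constant \<open>\<xi>\<close>.\<close>
  define T where "T \<phi> t = \<xi> + integral {0..t} (\<lambda>s. h (\<phi> (s - d)))" for \<phi> t
  define P where "P j = (T ^^ j) (\<lambda>_. \<xi>)" for j
  have PS: "P (Suc j) t = \<xi> + integral {0..t} (\<lambda>s. h (P j (s - d)))" for j t
    by (simp add: P_def T_def)
  have M0: "0 \<le> M" using M[of 0] norm_ge_zero order_trans by blast
  have lip: "norm (P j t - P j s) \<le> M * \<bar>t - s\<bar>" for j s t
  proof (induction j arbitrary: s t)
    case 0
    then show ?case using M0 by (simp add: P_def)
  next
    case (Suc j)
    have "continuous_on UNIV (P j)" using Suc by (rule lipschitz_bound_imp_continuous)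
    then have "continuous_on UNIV (\<lambda>s. h (P j (s - d)))"
      by (rule continuous_on_compose2[OF h continuous_on_compose2[where f = "\<lambda>s. s - d"]])
        (auto intro: continuous_intros)
    from integral_from_0_lipschitz[OF this M, of t s] show ?case by (simp add: PS)
  qed
  \<comment> \<open>The \<open>j\<close>-th iterate is final up to time \<open>j * d\<close>: for
    \<open>t\<close> up to \<open>(j + 1) * d\<close> the integrand only reads times up to
    \<open>j * d\<close>. For \<open>j = 0\<close> the integral vanishes because
    \<open>t \<le> 0\<close>.\<close>
  have agree: "P (Suc j) t = P j t" if "t \<le> real j * d" for j t
    using that
  proof (induction j arbitrary: t)
    case 0
    then show ?case by (cases "t = 0") (auto simp: P_def T_def)
  next
    case (Suc j)
    have "integral {0..t} (\<lambda>s. h (P (Suc j) (s - d))) = integral {0..t} (\<lambda>s. h (P j (s - d)))"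
      using Suc by (intro Henstock_Kurzweil_Integration.integral_cong arg_cong[where f = h])
        (auto simp: algebra_simps)
    then show ?case by (subst (1 2) PS) simp
  qed
  have agree': "P (j + i) t = P j t" if "t \<le> real j * d" for i j t
  proof (induction i)
    case (Suc i)
    have "real j * d \<le> real (j + i) * d" using d by (intro mult_right_mono) auto
    then show ?case using Suc agree[of t "j + i"] that by simp
  qed simp
  \<comment> \<open>The index is the first at which the iterate is guaranteed to be final at
    \<open>t\<close>; \<open>nat\<close> sends negative times to index 0, where the iterate is
    \<open>\<xi>\<close>.\<close>
  define \<phi> where "\<phi> t = P (nat \<lceil>t / d\<rceil>) t" for t
  have \<phi>: "\<phi> t = P j t" if "t \<le> real j * d" for t j
  proof -
    have "nat \<lceil>t / d\<rceil> \<le> j" using that d by (simp add: ceiling_le_iff nat_le_iff divide_simps)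
    moreover have "t \<le> real (nat \<lceil>t / d\<rceil>) * d"
    proof -
      have "t / d \<le> real (nat \<lceil>t / d\<rceil>)" by linarith
      then show ?thesis using d by (simp add: divide_simps)
    qed
    ultimately show ?thesis
      using agree'[of t "nat \<lceil>t / d\<rceil>" "j - nat \<lceil>t / d\<rceil>"] by (simp add: \<phi>_def)
  qed
  have ex: "\<exists>j. t \<le> real j * d" for t
    using reals_Archimedean3[OF d] by (meson less_le)
  show thesis
  proof (rule that)
    fix t
    obtain j where j: "t \<le> real j * d" using ex by blast
    have "integral {0..t} (\<lambda>s. h (\<phi> (s - d))) = integral {0..t} (\<lambda>s. h (P j (s - d)))"
      using j d by (intro Henstock_Kurzweil_Integration.integral_cong arg_cong[where f = h] \<phi>)
        (auto simp: algebra_simps)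
    then show "\<phi> t = \<xi> + integral {0..t} (\<lambda>s. h (\<phi> (s - d)))"
      using PS[of j t] agree[OF j] \<phi>[OF j] by simp
  next
    fix s t
    obtain j where j: "max s t \<le> real j * d" using ex by blast
    then show "norm (\<phi> t - \<phi> s) \<le> M * \<bar>t - s\<bar>"
      using lip[of j t s] \<phi>[of s j] \<phi>[of t j] by simp
  qed
qed

text \<open>A diagonal subsequence converges at every rational, and the common Lipschitz constant
  carries the Cauchy property over to every real. Pointwise convergence is what dominated
  convergence will use.\<close>

lemma equilipschitz_pointwise_convergent_subsequence:
  fixes f :: "nat \<Rightarrow> real \<Rightarrow> 'a::euclidean_space"
  assumes f0: "\<And>n. f n 0 = \<xi>" and lip: "\<And>n s t. norm (f n t - f n s) \<le> M * \<bar>t - s\<bar>"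
  obtains k g where "strict_mono (k :: nat \<Rightarrow> nat)" "\<And>t. (\<lambda>n. f (k n) t) \<longlonglongrightarrow> g t"
proof -
  have M0: "0 \<le> M" using order_trans[OF norm_ge_zero lip[of 0 1 0]] by simp
  \<comment> \<open>The weight turns linear growth in \<open>q\<close> into a single bound valid for
    all \<open>q\<close>, as the diagonal argument requires.\<close>
  have bd: "norm (f n q /\<^sub>R (1 + \<bar>q\<bar>)) \<le> norm \<xi> + M" for n q
  proof -
    have "norm (f n q) \<le> norm \<xi> + M * \<bar>q\<bar>"
      using lip[of n q 0] norm_triangle_sub[of "f n q" \<xi>] by (simp add: f0)
    also have "\<dots> \<le> (norm \<xi> + M) * (1 + \<bar>q\<bar>)" using M0 by (simp add: algebra_simps)
    finally show ?thesis by (simp add: divide_simps)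
  qed
  obtain k :: "nat \<Rightarrow> nat" where k: "strict_mono k"
    and kl: "\<And>q. q \<in> \<rat> \<Longrightarrow> \<exists>l. (\<lambda>n. f (k n) q /\<^sub>R (1 + \<bar>q\<bar>)) \<longlonglongrightarrow> l"
    by (rule function_convergent_subsequence[OF countable_rat, of "\<lambda>n q. f n q /\<^sub>R (1 + \<bar>q\<bar>)", OF bd])
      blast
  have conv: "Cauchy (\<lambda>n. f (k n) q)" if "q \<in> \<rat>" for q
  proof -
    obtain l where "(\<lambda>n. f (k n) q /\<^sub>R (1 + \<bar>q\<bar>)) \<longlonglongrightarrow> l" using kl[OF \<open>q \<in> \<rat>\<close>] by blast
    from tendsto_scaleR[OF tendsto_const[of "1 + \<bar>q\<bar>"] this]
    have "(\<lambda>n. f (k n) q) \<longlonglongrightarrow> (1 + \<bar>q\<bar>) *\<^sub>R l"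
      by (simp add: add_nonneg_eq_0_iff)
    then show ?thesis by (rule LIMSEQ_imp_Cauchy)
  qed
  have "Cauchy (\<lambda>n. f (k n) t)" for t
  proof (rule metric_CauchyI)
    fix e :: real assume e: "e > 0"
    \<comment> \<open>A rational so near \<open>t\<close> that every member of the family moves by
      less than \<open>e / 3\<close> between them; \<open>M + 1\<close> keeps the quotient
      meaningful for \<open>M = 0\<close>.\<close>
    obtain q where q: "q \<in> \<rat>" "t < q" "q < t + e / (3 * (M + 1))"
      using Rats_dense_in_real[of t "t + e / (3 * (M + 1))"] e M0 by auto
    have Mq: "M * \<bar>t - q\<bar> < e / 3"
    proof -
      have "M * \<bar>t - q\<bar> \<le> (M + 1) * \<bar>t - q\<bar>" by (intro mult_right_mono) auto
      also have "\<dots> < (M + 1) * (e / (3 * (M + 1)))" using q M0 by (intro mult_strict_left_mono) auto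
      also have "\<dots> = e / 3" using M0 by (simp add: divide_simps)
      finally show ?thesis .
    qed
    obtain n0 where n0: "\<And>m n. m \<ge> n0 \<Longrightarrow> n \<ge> n0 \<Longrightarrow> dist (f (k m) q) (f (k n) q) < e / 3"
      using metric_CauchyD[OF conv[OF q(1)], of "e / 3"] e by auto
    show "\<exists>n0. \<forall>m\<ge>n0. \<forall>n\<ge>n0. dist (f (k m) t) (f (k n) t) < e"
    proof (intro exI allI impI)
      fix m n assume mn: "m \<ge> n0" "n \<ge> n0"
      have "dist (f (k m) t) (f (k m) q) < e / 3" "dist (f (k n) t) (f (k n) q) < e / 3"
        using lip[of "k m" t q] lip[of "k n" t q] Mq by (auto simp: dist_norm)
      with n0[OF mn] show "dist (f (k m) t) (f (k n) t) < e"
        using dist_triangle[of "f (k m) t" "f (k n) t" "f (k m) q"]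
          dist_triangle[of "f (k m) q" "f (k n) t" "f (k n) q"] dist_commute[of "f (k n) q" "f (k n) t"]
        by linarith
    qed
  qed
  then have "\<exists>g. \<forall>t. (\<lambda>n. f (k n) t) \<longlonglongrightarrow> g t"
    by (meson Cauchy_convergent convergent_def)
  then show thesis using that k by blast
qed

lemma integral_equation_imp_solves_on:
  fixes h :: "real^'n::finite \<Rightarrow> real^'n"
  assumes h: "continuous_on UNIV h" and \<phi>: "continuous_on {0..} \<phi>"
    and eq: "\<And>t. 0 \<le> t \<Longrightarrow> \<phi> t = \<xi> + integral {0..t} (\<lambda>s. h (\<phi> s))"
  shows "solves_on h {0..} \<phi>"
  unfolding solves_on_def
proof
  fix t :: real assume t: "t \<in> {0..}"
  \<comment> \<open>Going past \<open>t\<close> makes \<open>{0..t + 1}\<close> and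
    \<open>{0..}\<close> agree near \<open>t\<close>, so that the derivative transfers.\<close>
  have "continuous_on {0..t + 1} (\<lambda>s. h (\<phi> s))"
    using \<phi> by (intro continuous_on_compose2[OF h]) (auto intro: continuous_on_subset)
  from integral_has_vector_derivative[OF this, of t] t
  have "((\<lambda>u. \<xi> + integral {0..u} (\<lambda>s. h (\<phi> s))) has_vector_derivative h (\<phi> t)) (at t within {0..t + 1})"
    by (auto intro!: derivative_eq_intros)
  then have "(\<phi> has_vector_derivative h (\<phi> t)) (at t within {0..t + 1})"
    using t by (auto intro: has_vector_derivative_transform[rotated 2] simp: eq)
  moreover have "at t within {0..t + 1} = at t within {0..}"
    using t by (intro at_within_nhd[where S = "{..<t + 1}"]) auto
  ultimately show "(\<phi> has_vector_derivative h (\<phi> t)) (at t within {0..})" by simp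
qed

theorem peano_global_bounded:
  fixes h :: "real^'n::finite \<Rightarrow> real^'n"
  assumes h: "continuous_on UNIV h" and M: "\<And>y. norm (h y) \<le> M"
  obtains \<phi> where "solves_on h {0..} \<phi>" "\<phi> 0 = \<xi>"
proof -
  define d where "d n = 1 / real (Suc n)" for n
  have d: "d n > 0" for n by (simp add: d_def)
  have "\<exists>\<phi>. (\<forall>t. \<phi> t = \<xi> + integral {0..t} (\<lambda>s. h (\<phi> (s - d n)))) \<and>
      (\<forall>s t. norm (\<phi> t - \<phi> s) \<le> M * \<bar>t - s\<bar>)" for n
    by (rule delayed_integral_equation[OF h M d, of \<xi> n]) blast
  then obtain f where f: "\<And>n t. f n t = \<xi> + integral {0..t} (\<lambda>s. h (f n (s - d n)))"
    and lip: "\<And>n s t. norm (f n t - f n s) \<le> M * \<bar>t - s\<bar>" by metis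
  have f0: "f n 0 = \<xi>" for n by (subst f) simp
  obtain k g where k: "strict_mono (k :: nat \<Rightarrow> nat)" and g: "\<And>t. (\<lambda>n. f (k n) t) \<longlonglongrightarrow> g t"
    using equilipschitz_pointwise_convergent_subsequence[of f \<xi> M, OF f0 lip] by blast
  have "norm (g t - g s) \<le> M * \<bar>t - s\<bar>" for s t
    using lip by (intro tendsto_upperbound[OF tendsto_norm[OF tendsto_diff[OF g g]]]) auto
  then have cg: "continuous_on UNIV g" by (rule lipschitz_bound_imp_continuous)
  have cf: "continuous_on UNIV (\<lambda>s. h (f n (s - d n)))" for n
    using lipschitz_bound_imp_continuous[OF lip, of n]
    by (rule continuous_on_compose2[OF h continuous_on_compose2[where f = "\<lambda>s. s - d n"]])
      (auto intro: continuous_intros)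
  have dk: "(\<lambda>n. d (k n)) \<longlonglongrightarrow> 0"
    using LIMSEQ_subseq_LIMSEQ[OF LIMSEQ_inverse_real_of_nat k] by (simp add: d_def o_def inverse_eq_divide)
  \<comment> \<open>By the Lipschitz bound the delay displaces the argument of \<open>h\<close> by
    at most \<open>M * d (k n)\<close>, which tends to 0.\<close>
  have conv: "(\<lambda>n. h (f (k n) (s - d (k n)))) \<longlonglongrightarrow> h (g s)" for s
  proof -
    have "(\<lambda>n. f (k n) (s - d (k n)) - f (k n) s) \<longlonglongrightarrow> 0"
    proof (rule Lim_null_comparison)
      show "\<forall>\<^sub>F n in sequentially. norm (f (k n) (s - d (k n)) - f (k n) s) \<le> M * d (k n)"
        using lip[of "k _" "s - d (k _)" s] d by (auto simp: less_imp_le abs_of_pos)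
      show "(\<lambda>n. M * d (k n)) \<longlonglongrightarrow> 0" using tendsto_mult_right_zero[OF dk] by simp
    qed
    from tendsto_add[OF this g[of s]] have "(\<lambda>n. f (k n) (s - d (k n))) \<longlonglongrightarrow> g s" by simp
    moreover have "isCont h (g s)" using h by (simp add: continuous_on_eq_continuous_at)
    ultimately show ?thesis by (rule isCont_tendsto_compose[rotated])
  qed
  \<comment> \<open>The limit is taken in the delayed integral equation, with the constant
    \<open>M\<close> as integrable majorant.\<close>
  have eq: "g t = \<xi> + integral {0..t} (\<lambda>s. h (g s))" for t
  proof -
    have "(\<lambda>n. integral {0..t} (\<lambda>s. h (f (k n) (s - d (k n))))) \<longlonglongrightarrow> integral {0..t} (\<lambda>s. h (g s))"
    proof (rule dominated_convergence(2))
      show "(\<lambda>s. h (f (k n) (s - d (k n)))) integrable_on {0..t}" for n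
        using cf[of "k n"] by (intro integrable_continuous_real) (auto intro: continuous_on_subset)
      show "(\<lambda>_. M) integrable_on {0..t}" by (rule integrable_const_ivl)
    qed (use M conv in auto)
    from tendsto_add[OF tendsto_const[of \<xi>] this] have "(\<lambda>n. f (k n) t) \<longlonglongrightarrow> \<xi> + integral {0..t} (\<lambda>s. h (g s))"
      by (simp add: f[symmetric])
    then show ?thesis using g[of t] LIMSEQ_unique by blast
  qed
  show thesis
  proof (rule that)
    show "solves_on h {0..} g"
      using continuous_on_subset[OF cg subset_UNIV] eq by (rule integral_equation_imp_solves_on[OF h])
    show "g 0 = \<xi>" by (subst eq) simp
  qed
qed

subsection \<open>Lyapunov's direct method\<close>

lemma solves_on_continuous:
  assumes "solves_on h J \<phi>"
  shows "continuous_on J \<phi>"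
  using assms unfolding solves_on_def continuous_on_eq_continuous_within
  by (blast intro: has_vector_derivative_continuous)

lemma solves_on_derivative_interior:
  assumes "solves_on h J \<phi>" "{a..b} \<subseteq> J" "a < t" "t < b"
  shows "(\<phi> has_vector_derivative h (\<phi> t)) (at t)"
proof -
  have "t \<in> J" "{a<..<b} \<subseteq> J" using assms(2-4) by (auto simp: subset_eq)
  then have "(\<phi> has_vector_derivative h (\<phi> t)) (at t within {a<..<b})"
    using assms(1) has_vector_derivative_within_subset unfolding solves_on_def by blast
  then show ?thesis
    using has_vector_derivative_within_open[of t "{a<..<b}" \<phi>] assms(3,4) by simp
qed

text \<open>By the chain rule \<open>V (\<phi> t) + \<eta> * t\<close> has nonpositive derivative
  inside the interval. With \<open>\<eta> = 0\<close> this yields monotonicity, for the original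
  field and for its rescaling; with \<open>\<eta> > 0\<close> it is the linear decay that forces
  convergence.\<close>

lemma decrease_along_solution:
  fixes V :: "real^'n::finite \<Rightarrow> real"
  assumes V: "\<And>x. (V has_derivative (\<lambda>y. g x \<bullet> y)) (at x)"
    and sol: "solves_on h J \<phi>" and ab: "{a..b} \<subseteq> J" "a \<le> b"
    and decr: "\<And>t. t \<in> {a..b} \<Longrightarrow> g (\<phi> t) \<bullet> h (\<phi> t) \<le> - \<eta>"
  shows "V (\<phi> b) \<le> V (\<phi> a) - \<eta> * (b - a)"
proof -
  have cV: "continuous_on UNIV V"
    using has_derivative_continuous[OF V] by (simp add: continuous_on_eq_continuous_at)
  have "V (\<phi> a) + \<eta> * a \<ge> V (\<phi> b) + \<eta> * b"
  proof (rule DERIV_nonpos_imp_decreasing_open[OF \<open>a \<le> b\<close>])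
    fix t assume t: "a < t" "t < b"
    have "((V \<circ> \<phi>) has_vector_derivative g (\<phi> t) \<bullet> h (\<phi> t)) (at t)"
      using vector_derivative_diff_chain_within[OF solves_on_derivative_interior[OF sol ab(1) t]
          has_derivative_at_withinI[OF V]] by simp
    then have "DERIV (\<lambda>t. V (\<phi> t) + \<eta> * t) t :> g (\<phi> t) \<bullet> h (\<phi> t) + \<eta>"
      by (auto intro!: derivative_eq_intros simp: o_def has_real_derivative_iff_has_vector_derivative[symmetric])
    then show "\<exists>y. DERIV (\<lambda>t. V (\<phi> t) + \<eta> * t) t :> y \<and> y \<le> 0"
      using decr[of t] t by (intro exI[of _ "g (\<phi> t) \<bullet> h (\<phi> t) + \<eta>"]) auto
  next
    have "continuous_on {a..b} \<phi>" using solves_on_continuous[OF sol] ab(1) by (rule continuous_on_subset)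
    then show "continuous_on {a..b} (\<lambda>t. V (\<phi> t) + \<eta> * t)"
      by (intro continuous_intros continuous_on_compose2[OF cV]) auto
  qed
  then show ?thesis by (simp add: algebra_simps)
qed

text \<open>The setting of the direct method, with \<open>g\<close> the gradient of
  \<open>V\<close>; later \<open>h\<close> is the closed loop of one fixed consistent pair.\<close>

locale lyapunov =
  fixes V :: "real^'n::finite \<Rightarrow> real" and g h :: "real^'n \<Rightarrow> real^'n"
  assumes V_deriv: "\<And>x. (V has_derivative (\<lambda>y. g x \<bullet> y)) (at x)"
    and g_cont: "continuous_on UNIV g" and h_cont: "continuous_on UNIV h"
    and V_zero: "V 0 = 0" and V_pos: "\<And>x. x \<noteq> 0 \<Longrightarrow> V x > 0"
    and V_unbounded: "radially_unbounded V"
    and h_zero: "h 0 = 0" and decreasing: "\<And>x. x \<noteq> 0 \<Longrightarrow> g x \<bullet> h x < 0"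
begin

lemma V_cont: "continuous_on UNIV V"
  using has_derivative_continuous[OF V_deriv] by (simp add: continuous_on_eq_continuous_at)

lemma V_nonneg: "0 \<le> V x"
  using V_zero V_pos[of x] by (cases "x = 0") auto

text \<open>Radial unboundedness gives boundedness, continuity closedness. These sets trap solutions
  and bound the field along them, which excludes finite escape.\<close>

lemma compact_sublevel: "compact {x. V x \<le> c}"
proof -
  have "\<forall>\<^sub>F x in at_infinity. c < V x"
    using V_unbounded by (simp add: radially_unbounded_def filterlim_at_top_dense)
  then obtain b where b: "\<And>x. b \<le> norm x \<Longrightarrow> c < V x"
    by (auto simp: eventually_at_infinity)
  have "bounded {x. V x \<le> c}"
  proof (rule boundedI)
    fix x assume "x \<in> {x. V x \<le> c}"
    then show "norm x \<le> b" using b[of x] by force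
  qed
  moreover have "closed {x. V x \<le> c}" by (intro closed_Collect_le V_cont continuous_on_const)
  ultimately show ?thesis by (simp add: compact_eq_bounded_closed)
qed

lemma V_antimono:
  assumes "solves_on h J \<phi>" "{a..b} \<subseteq> J" "a \<le> b"
  shows "V (\<phi> b) \<le> V (\<phi> a)"
proof -
  have "g x \<bullet> h x \<le> - 0" for x using decreasing[of x] h_zero by (cases "x = 0") auto
  with decrease_along_solution[OF V_deriv assms, of 0] show ?thesis by simp
qed

text \<open>Rescaling the field to make it bounded changes only the speed of the solutions, so \<open>V\<close> still
  decreases; a solution of the rescaled field stays in a sublevel set on which the field is unchanged.\<close>

lemma global_solution_exists:
  obtains \<phi> where "solves_on h {0..} \<phi>" "\<phi> 0 = \<xi>"
proof -
  have "bounded (h ` {x. V x \<le> V \<xi>})"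
    using compact_sublevel h_cont
    by (intro compact_imp_bounded compact_continuous_image) (auto intro: continuous_on_subset)
  then obtain M where M: "M > 0" and hM: "\<And>x. V x \<le> V \<xi> \<Longrightarrow> norm (h x) \<le> M"
    by (auto simp: bounded_pos)
  define k where "k x = (M / max M (norm (h x))) *\<^sub>R h x" for x
  have "continuous_on UNIV k"
    unfolding k_def using M by (intro continuous_intros h_cont) (auto simp: max_def)
  moreover have "norm (k x) \<le> M" for x
    using M by (auto simp: k_def max_def)
  ultimately obtain \<phi> where \<phi>: "solves_on k {0..} \<phi>" "\<phi> 0 = \<xi>"
    using peano_global_bounded by blast
  have "V (\<phi> t) \<le> V \<xi>" if "t \<ge> 0" for t
  proof -
    have "g x \<bullet> k x \<le> - 0" for x
    proof (cases "x = 0")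
      case False
      have "0 \<le> M / max M (norm (h x))" using M by auto
      then show ?thesis using decreasing[OF False]
        by (simp add: k_def mult_nonneg_nonpos del: times_divide_eq_left)
    qed (simp add: k_def h_zero)
    then show ?thesis using decrease_along_solution[OF V_deriv \<phi>(1), of 0 t 0] that \<phi>(2) by auto
  qed
  then have "k (\<phi> t) = h (\<phi> t)" if "t \<ge> 0" for t
    using hM[of "\<phi> t"] M that by (simp add: k_def max_absorb1)
  with \<phi> show thesis by (intro that[of \<phi>]) (auto simp: solves_on_def)
qed

text \<open>The minimum of \<open>V\<close> on the sphere of radius \<open>\<epsilon>\<close> is a
  barrier: a solution starting below it cannot reach the sphere, as \<open>V\<close> does not
  increase. \<open>J\<close> and \<open>a\<close> are free so that the estimate can be restarted at
  a later time to prove convergence.\<close>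

lemma stable:
  assumes "\<epsilon> > 0"
  obtains \<delta> where "\<delta> > 0"
    "\<And>J \<phi> a b. \<lbrakk>solves_on h J \<phi>; {a..b} \<subseteq> J; a \<le> b; norm (\<phi> a) < \<delta>\<rbrakk> \<Longrightarrow> norm (\<phi> b) < \<epsilon>"
proof -
  have "\<exists>p\<in>sphere (0 :: real^'n) \<epsilon>. \<forall>y\<in>sphere 0 \<epsilon>. V p \<le> V y"
    using assms by (intro continuous_attains_inf continuous_on_subset[OF V_cont]) auto
  then obtain p where p: "norm p = \<epsilon>" and pm: "\<And>y. norm y = \<epsilon> \<Longrightarrow> V p \<le> V y" by auto
  have "V p > 0" using p assms by (intro V_pos) auto
  moreover have "isCont V 0" using V_cont by (simp add: continuous_on_eq_continuous_at)
  ultimately obtain r where r: "r > 0" and rV: "\<And>x. norm x < r \<Longrightarrow> V x < V p"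
    unfolding continuous_at_eps_delta using V_zero by (auto simp: dist_norm abs_less_iff)
  show thesis
  proof (rule that)
    \<comment> \<open>\<open>r\<close> puts the start below the barrier; \<open>\<epsilon>\<close>
      puts it inside the sphere, so that an exit must meet the sphere by the intermediate value
      theorem.\<close>
    show "min r \<epsilon> > 0" using r assms by simp
    fix J \<phi> a b
    assume sol: "solves_on h J \<phi>" and ab: "{a..b} \<subseteq> J" "a \<le> b" and small: "norm (\<phi> a) < min r \<epsilon>"
    show "norm (\<phi> b) < \<epsilon>"
    proof (rule ccontr)
      assume "\<not> norm (\<phi> b) < \<epsilon>"
      moreover have "continuous_on {a..b} (\<lambda>t. norm (\<phi> t))"
        using solves_on_continuous[OF sol] ab(1) by (intro continuous_intros) (rule continuous_on_subset)
      ultimately obtain t where t: "a \<le> t" "t \<le> b" "norm (\<phi> t) = \<epsilon>"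
        using IVT'[of "\<lambda>t. norm (\<phi> t)" a \<epsilon> b] small ab(2) by auto
      have "V (\<phi> t) \<le> V (\<phi> a)" using t ab by (intro V_antimono[OF sol]) auto
      with rV[of "\<phi> a"] pm[OF t(3)] small show False by simp
    qed
  qed
qed

text \<open>A solution staying at distance at least \<open>\<delta>\<close> from 0 would live in a
  compact set where \<open>g x \<bullet> h x\<close> has a negative maximum, driving
  \<open>V\<close> below 0. So it enters the \<open>\<delta>\<close>-ball, after which
  \<open>stable\<close> keeps it in the \<open>\<epsilon>\<close>-ball.\<close>

lemma attractive:
  assumes sol: "solves_on h {0..} \<phi>"
  shows "(\<phi> \<longlongrightarrow> 0) at_top"
proof (rule tendstoI)
  fix \<epsilon> :: real assume "\<epsilon> > 0"
  then obtain \<delta> where \<delta>: "\<delta> > 0" and st: "\<And>J \<phi> a b. \<lbrakk>solves_on h J \<phi>; {a..b} \<subseteq> J; a \<le> b; norm (\<phi> a) < \<delta>\<rbrakk> \<Longrightarrow> norm (\<phi> b) < \<epsilon>"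
    by (rule stable) blast
  have "\<exists>a\<ge>0. norm (\<phi> a) < \<delta>"
  proof (rule ccontr)
    assume "\<not> (\<exists>a\<ge>0. norm (\<phi> a) < \<delta>)"
    then have far: "\<delta> \<le> norm (\<phi> t)" if "t \<ge> 0" for t using that by force
    define C where "C = {x. V x \<le> V (\<phi> 0)} \<inter> {x. \<delta> \<le> norm x}"
    have inC: "\<phi> t \<in> C" if "t \<ge> 0" for t
      using V_antimono[OF sol, of 0 t] far[OF that] that by (auto simp: C_def)
    have "compact C" unfolding C_def
      by (intro compact_Int_closed compact_sublevel closed_Collect_le continuous_intros)
    moreover have "continuous_on C (\<lambda>x. g x \<bullet> h x)"
      by (intro continuous_intros continuous_on_subset[OF g_cont] continuous_on_subset[OF h_cont]) auto
    ultimately obtain p where p: "p \<in> C" "\<And>x. x \<in> C \<Longrightarrow> g x \<bullet> h x \<le> g p \<bullet> h p"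
      using continuous_attains_sup[of C "\<lambda>x. g x \<bullet> h x"] inC[of 0] by auto
    define \<eta> where "\<eta> = - (g p \<bullet> h p)"
    have "p \<noteq> 0" using p(1) \<delta> by (auto simp: C_def)
    then have \<eta>: "\<eta> > 0" using decreasing[of p] by (simp add: \<eta>_def)
    \<comment> \<open>By this time decay at rate \<open>\<eta>\<close> has consumed
      \<open>V (\<phi> 0)\<close> and a further \<open>\<eta>\<close>.\<close>
    define t where "t = V (\<phi> 0) / \<eta> + 1"
    have t: "t \<ge> 0" using V_nonneg[of "\<phi> 0"] \<eta> by (simp add: t_def)
    have "V (\<phi> t) \<le> V (\<phi> 0) - \<eta> * (t - 0)"
      using t p(2) inC by (intro decrease_along_solution[OF V_deriv sol]) (auto simp: \<eta>_def)
    also have "\<dots> = - \<eta>" using \<eta> by (simp add: t_def field_simps)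
    finally show False using V_nonneg[of "\<phi> t"] \<eta> by simp
  qed
  then obtain a where a: "a \<ge> 0" "norm (\<phi> a) < \<delta>" by blast
  have "norm (\<phi> t) < \<epsilon>" if "t \<ge> a" for t
    using that a by (intro st[OF sol, of a t]) auto
  then show "\<forall>\<^sub>F t in at_top. dist (\<phi> t) 0 < \<epsilon>"
    by (auto simp: eventually_at_top_linorder)
qed

text \<open>The solution stays in a compact sublevel set, where \<open>h\<close> is bounded; so it
  is Lipschitz, hence uniformly continuous, and has a limit at \<open>\<tau>\<close>.\<close>

lemma extends_continuously:
  assumes \<tau>: "\<tau> > 0" and sol: "solves_on h {0..<\<tau>} \<phi>"
  obtains \<mu> where "continuous_on {0..\<tau>} \<mu>" "\<And>t. t \<in> {0..<\<tau>} \<Longrightarrow> \<mu> t = \<phi> t"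
proof -
  have "bounded (h ` {x. V x \<le> V (\<phi> 0)})"
    using compact_sublevel h_cont
    by (intro compact_imp_bounded compact_continuous_image) (auto intro: continuous_on_subset)
  then obtain M where M: "M > 0" and hM: "\<And>x. V x \<le> V (\<phi> 0) \<Longrightarrow> norm (h x) \<le> M"
    by (auto simp: bounded_pos)
  have "norm (h (\<phi> t)) \<le> M" if "t \<in> {0..<\<tau>}" for t
    using that by (intro hM V_antimono[OF sol]) auto
  then have "norm (\<phi> t - \<phi> s) \<le> M * norm (t - s)" if "s \<in> {0..<\<tau>}" "t \<in> {0..<\<tau>}" for s t
    using that sol unfolding solves_on_def
    by (intro differentiable_bound[of "{0..<\<tau>}" \<phi> "\<lambda>t y. y *\<^sub>R h (\<phi> t)"] onorm_le)
      (auto simp: has_vector_derivative_def mult.commute[of M] mult_left_mono)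
  then have "M-lipschitz_on {0..<\<tau>} \<phi>"
    using M by (auto intro!: lipschitz_onI simp: dist_norm)
  then have "uniformly_continuous_on {0..<\<tau>} \<phi>" by (rule lipschitz_on_uniformly_continuous)
  then show thesis
    using uniformly_continuous_on_extension_on_closure[of "{0..<\<tau>}" \<phi>] \<tau> that
      uniformly_continuous_imp_continuous by (metis closure_atLeastLessThan)
qed

text \<open>A global solution started at the limit \<open>\<mu> \<tau>\<close> is appended to the
  given one.\<close>

lemma solution_extends:
  assumes \<tau>: "\<tau> > 0" and sol: "solves_on h {0..<\<tau>} \<phi>"
  obtains \<psi> where "solves_on h {0..} \<psi>" "\<And>t. t \<in> {0..<\<tau>} \<Longrightarrow> \<psi> t = \<phi> t"
proof -
  obtain \<mu> where \<mu>: "continuous_on {0..\<tau>} \<mu>" "\<And>t. t \<in> {0..<\<tau>} \<Longrightarrow> \<mu> t = \<phi> t"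
    by (rule extends_continuously[OF \<tau> sol]) blast
  obtain \<rho> where \<rho>: "solves_on h {0..} \<rho>" "\<rho> 0 = \<mu> \<tau>" by (rule global_solution_exists)
  define \<psi> where "\<psi> t = (if t \<le> \<tau> then \<mu> t else \<rho> (t - \<tau>))" for t
  have "continuous_on {\<tau>..} (\<lambda>t. \<rho> (t - \<tau>))"
    by (rule continuous_on_compose2[OF solves_on_continuous[OF \<rho>(1)]]) (auto intro!: continuous_intros)
  then have "continuous_on ({0..\<tau>} \<union> {\<tau>..}) \<psi>"
    unfolding \<psi>_def using \<mu>(1) \<rho>(2) by (intro continuous_on_cases) auto
  moreover have "{0..\<tau>} \<union> {\<tau>..} = {0..}" using \<tau> by auto
  ultimately have c\<psi>: "continuous_on {0..} \<psi>" by simp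
  have deriv: "(\<psi> has_vector_derivative h (\<psi> t)) (at t)" if t: "0 < t" "t \<noteq> \<tau>" for t
  proof (cases "t < \<tau>")
    case True
    have "(\<phi> has_vector_derivative h (\<phi> t)) (at t)"
      using True t by (intro solves_on_derivative_interior[OF sol, of 0 "(t + \<tau>) / 2"]) auto
    then have "(\<psi> has_vector_derivative h (\<phi> t)) (at t)"
      by (rule has_vector_derivative_transform_within_open[of _ _ _ "{0<..<\<tau>}"])
        (use True t \<mu>(2) in \<open>auto simp: \<psi>_def\<close>)
    then show ?thesis using True t \<mu>(2) by (simp add: \<psi>_def)
  next
    case False
    have "(\<rho> has_vector_derivative h (\<rho> (t - \<tau>))) (at (t - \<tau>))"
      using False t by (intro solves_on_derivative_interior[OF \<rho>(1), of 0 "t - \<tau> + 1"]) auto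
    moreover have shift: "((\<lambda>t. t - \<tau>) has_vector_derivative 1) (at t)"
      by (auto intro!: derivative_eq_intros)
    ultimately have "((\<lambda>t. \<rho> (t - \<tau>)) has_vector_derivative h (\<rho> (t - \<tau>))) (at t)"
      using vector_diff_chain_at[of "\<lambda>t. t - \<tau>" 1 t \<rho> "h (\<rho> (t - \<tau>))"]
      by (simp add: o_def shift)
    then have "(\<psi> has_vector_derivative h (\<rho> (t - \<tau>))) (at t)"
      by (rule has_vector_derivative_transform_within_open[of _ _ _ "{\<tau><..}"])
        (use False t in \<open>auto simp: \<psi>_def\<close>)
    then show ?thesis using False t by (simp add: \<psi>_def)
  qed
  \<comment> \<open>The joint \<open>\<tau>\<close> is an exceptional point in the fundamental
    theorem of calculus; differentiability there is recovered from the integral equation.\<close>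
  have eq: "\<psi> t = \<psi> 0 + integral {0..t} (\<lambda>s. h (\<psi> s))" if "t \<ge> 0" for t
  proof -
    have "((\<lambda>s. h (\<psi> s)) has_integral (\<psi> t - \<psi> 0)) {0..t}"
      by (rule fundamental_theorem_of_calculus_interior_strong[of "{\<tau>}"])
        (use that deriv continuous_on_subset[OF c\<psi>, of "{0..t}"] in auto)
    then show ?thesis by (simp add: integral_unique)
  qed
  show thesis
  proof (rule that)
    show "solves_on h {0..} \<psi>" by (rule integral_equation_imp_solves_on[OF h_cont c\<psi> eq])
    show "\<psi> t = \<phi> t" if "t \<in> {0..<\<tau>}" for t using that \<mu>(2) by (simp add: \<psi>_def)
  qed
qed

theorem globally_asymptotically_stable: "globally_asymptotically_stable h"
  unfolding globally_asymptotically_stable_def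
proof (intro conjI allI impI)
  show "h 0 = 0" by (rule h_zero)
next
  fix \<epsilon> :: real assume "\<epsilon> > 0"
  then obtain \<delta> where "\<delta> > 0" and st: "\<And>J \<phi> a b. \<lbrakk>solves_on h J \<phi>; {a..b} \<subseteq> J; a \<le> b; norm (\<phi> a) < \<delta>\<rbrakk> \<Longrightarrow> norm (\<phi> b) < \<epsilon>"
    by (rule stable) blast
  have "norm (\<phi> t) < \<epsilon>" if "solves_on h {0..<\<tau>} \<phi>" "norm (\<phi> 0) < \<delta>" "t \<in> {0..<\<tau>}" for \<tau> \<phi> t
    using that by (intro st[of "{0..<\<tau>}" \<phi> 0 t]) auto
  with \<open>\<delta> > 0\<close> show "\<exists>\<delta>>0. \<forall>\<tau>>0. \<forall>\<phi>. solves_on h {0..<\<tau>} \<phi> \<and> norm (\<phi> 0) < \<delta>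
      \<longrightarrow> (\<forall>t\<in>{0..<\<tau>}. norm (\<phi> t) < \<epsilon>)" by blast
next
  fix \<xi> show "\<exists>\<phi>. solves_on h {0..} \<phi> \<and> \<phi> 0 = \<xi>" by (rule global_solution_exists) blast
next
  fix \<tau> :: real and \<phi> assume "\<tau> > 0" "solves_on h {0..<\<tau>} \<phi>"
  then show "\<exists>\<psi>. solves_on h {0..} \<psi> \<and> (\<forall>t\<in>{0..<\<tau>}. \<psi> t = \<phi> t)"
    by (rule solution_extends) blast
next
  fix \<phi> assume "solves_on h {0..} \<phi>"
  then show "(\<phi> \<longlongrightarrow> 0) at_top" by (rule attractive)
qed

end

section \<open>Gradients of polynomial functions\<close>

text \<open>The induction builds some continuous gradient \<open>g\<close>, since the partial
  derivatives in \<open>gradient\<close> carry no differentiability by themselves; the chain rule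
  along the coordinate axes then identifies the two.\<close>

lemma real_polynomial_function_gradient:
  fixes V :: "real^'n::finite \<Rightarrow> real"
  assumes "real_polynomial_function V"
  shows "(V has_derivative (\<lambda>y. gradient V x \<bullet> y)) (at x)" and "continuous_on UNIV (gradient V)"
proof -
  have "\<exists>g. continuous_on UNIV g \<and> (\<forall>x. (V has_derivative (\<lambda>y. g x \<bullet> y)) (at x))"
    using assms
  proof (induction rule: real_polynomial_function.induct)
    case (linear f)
    \<comment> \<open>Riesz representation: the vector representing the functional \<open>f\<close>
      is \<open>adjoint f 1\<close>.\<close>
    have "f y = adjoint f 1 \<bullet> y" for y
      using adjoint_works[OF bounded_linear.linear[OF linear], of y 1]
      by (metis inner_commute inner_real_def mult.right_neutral)
    then have "f = (\<lambda>y. adjoint f 1 \<bullet> y)" by blast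
    then have "(f has_derivative (\<lambda>y. adjoint f 1 \<bullet> y)) (at x)" for x
      using bounded_linear_imp_has_derivative[OF linear, of "at x"] by simp
    then show ?case by (intro exI[of _ "\<lambda>_. adjoint f 1"]) auto
  next
    case (const c)
    show ?case by (intro exI[of _ "\<lambda>_. 0"]) auto
  next
    case (add p q)
    then obtain a b where "continuous_on UNIV a" "continuous_on UNIV b"
      "\<And>x. (p has_derivative (\<lambda>y. a x \<bullet> y)) (at x)" "\<And>x. (q has_derivative (\<lambda>y. b x \<bullet> y)) (at x)"
      by blast
    then show ?case
      by (intro exI[of _ "\<lambda>x. a x + b x"])
        (auto intro!: continuous_intros derivative_eq_intros simp: inner_add_left)
  next
    case (mult p q)
    then obtain a b where ab: "continuous_on UNIV a" "continuous_on UNIV b"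
      "\<And>x. (p has_derivative (\<lambda>y. a x \<bullet> y)) (at x)" "\<And>x. (q has_derivative (\<lambda>y. b x \<bullet> y)) (at x)"
      by blast
    have "continuous_on UNIV p" "continuous_on UNIV q"
      using has_derivative_continuous[OF ab(3)] has_derivative_continuous[OF ab(4)]
      by (auto simp: continuous_on_eq_continuous_at)
    with ab show ?case
      by (intro exI[of _ "\<lambda>x. p x *\<^sub>R b x + q x *\<^sub>R a x"])
        (auto intro!: continuous_intros derivative_eq_intros simp: inner_add_left)
  qed
  then obtain g where g: "continuous_on UNIV g" "\<And>x. (V has_derivative (\<lambda>y. g x \<bullet> y)) (at x)" by blast
  have "gradient V x = g x" for x
  proof -
    have "deriv (\<lambda>s. V (x + s *\<^sub>R axis i 1)) 0 = g x $ i" for i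
    proof (rule DERIV_imp_deriv)
      have "((\<lambda>s. x + s *\<^sub>R axis i 1) has_vector_derivative axis i 1) (at 0)"
        by (auto intro!: derivative_eq_intros)
      from vector_derivative_diff_chain_within[OF this has_derivative_at_withinI[OF g(2)]]
      show "((\<lambda>s. V (x + s *\<^sub>R axis i 1)) has_real_derivative g x $ i) (at 0)"
        by (simp add: o_def has_real_derivative_iff_has_vector_derivative inner_axis)
    qed
    then show ?thesis by (simp add: gradient_def vec_eq_iff)
  qed
  then have "gradient V = g" by blast
  then show "(V has_derivative (\<lambda>y. gradient V x \<bullet> y)) (at x)" "continuous_on UNIV (gradient V)"
    using g by auto
qed

subsection \<open>Block matrices and inverses of submatrices\<close>

lemma sum_UNIV_Plus: "(\<Sum>i\<in>(UNIV :: ('a::finite + 'b::finite) set). f i) = (\<Sum>a\<in>UNIV. f (Inl a)) + (\<Sum>b\<in>UNIV. f (Inr b))"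
  by (simp add: UNIV_Plus_UNIV[symmetric] sum.Plus del: UNIV_Plus_UNIV)

lemma sum_UNIV_prod: "(\<Sum>i\<in>(UNIV :: ('a::finite \<times> 'b::finite) set). f i) = (\<Sum>a\<in>UNIV. \<Sum>b\<in>UNIV. f (a, b))"
  by (simp add: UNIV_Times_UNIV[symmetric] sum.cartesian_product del: UNIV_Times_UNIV)

lemma vcat_nth [simp]: "vcat a b $ Inl i = a $ i" "vcat a b $ Inr j = b $ j"
  by (simp_all add: vcat_def)

lemma hcat_nth [simp]: "hcat A B $ i = vcat (A $ i) (B $ i)"
  by (simp add: hcat_def)

lemma vec_eq_iff_Plus: "a = b \<longleftrightarrow> (\<forall>i. a $ Inl i = b $ Inl i) \<and> (\<forall>j. a $ Inr j = b $ Inr j)"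
  unfolding vec_eq_iff by (metis sum.exhaust)

lemma vcat_cases: obtains a b where "z = vcat a b"
  by (rule that[of "\<chi> i. z $ Inl i" "\<chi> j. z $ Inr j"]) (simp add: vec_eq_iff_Plus)

lemma inner_vcat: "vcat a b \<bullet> vcat c d = a \<bullet> c + b \<bullet> d"
  by (simp add: inner_vec_def sum_UNIV_Plus)

lemma vcat_mult_vec: "vcat P Q *v z = vcat (P *v z) (Q *v z)"
  by (simp add: vec_eq_iff_Plus matrix_vector_mult_def)

lemma transpose_vcat_mult_vec: "transpose (vcat P Q) *v vcat a b = transpose P *v a + transpose Q *v b"
  by (simp add: vec_eq_iff matrix_vector_mult_def transpose_def sum_UNIV_Plus)

lemma block_mult_vcat: "block A B C D *v vcat a b = vcat (A *v a + B *v b) (C *v a + D *v b)"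
  by (simp add: vec_eq_iff_Plus matrix_vector_mult_def block_def sum_UNIV_Plus)

lemma block_mult_block:
  "block A B C D ** block A' B' C' D' =
    block (A ** A' + B ** C') (A ** B' + B ** D') (C ** A' + D ** C') (C ** B' + D ** D')"
  by (simp add: vec_eq_iff_Plus matrix_matrix_mult_def block_def sum_UNIV_Plus)

lemma transpose_block:
  "transpose (block A B C D) = block (transpose A) (transpose C) (transpose B) (transpose D)"
  by (simp add: vec_eq_iff_Plus transpose_def block_def)

lemma block_eq_iff: "block A B C D = block A' B' C' D' \<longleftrightarrow> A = A' \<and> B = B' \<and> C = C' \<and> D = D'"
  unfolding block_def vec_eq_iff_Plus by (auto simp: vec_eq_iff)

lemma uminus_matrix_vector_mult: "(- A) *v z = - (A *v z)" and matrix_vector_mult_uminus: "A *v (- z) = - (A *v z)"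
  for A :: "real^'k::finite^'i::finite"
  by (simp_all add: vec_eq_iff matrix_vector_mult_def sum_negf)

lemma sel_nth [simp]: "sel \<sigma> v $ i = (if i \<in> \<sigma> then v $ i else 0)"
  by (simp add: sel_def)

lemma sel_sel [simp]: "sel \<sigma> (sel \<sigma> v) = sel \<sigma> v"
  by (simp add: vec_eq_iff)

lemma sel_add_compl: "sel s v + sel (- s) v = (v :: real^'i::finite)"
  by (simp add: vec_eq_iff)

lemma sel_zero [simp]: "sel \<sigma> (0 :: real^'i::finite) = 0"
  by (simp add: vec_eq_iff)

lemma sel_diff: "sel \<sigma> (a - b) = sel \<sigma> a - sel \<sigma> (b :: real^'i::finite)"
  by (simp add: vec_eq_iff)

lemma sel_uminus: "sel \<sigma> (- a) = - sel \<sigma> (a :: real^'i::finite)"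
  by (simp add: vec_eq_iff)

lemma inner_sel: "sel \<sigma> a \<bullet> b = a \<bullet> sel \<sigma> (b :: real^'i::finite)"
  by (auto simp: inner_vec_def intro!: sum.cong)

lemma transpose_sel_mult_vec: "transpose (sel \<sigma> D) *v q = transpose D *v sel \<sigma> (q :: real^'i::finite)"
  by (auto simp: vec_eq_iff matrix_vector_mult_def transpose_def intro!: sum.cong)

lemma id_on_mult_vec [simp]: "id_on \<sigma> *v z = sel \<sigma> z"
  by (auto simp: vec_eq_iff id_on_def matrix_vector_mult_def mat_def if_distrib[where f = "\<lambda>x. x * _"] sum.delta cong: if_cong)

lemma sel_matrix_mult: "sel \<sigma> M ** R = sel \<sigma> (M ** R)"
  for M :: "real^'k^'i::finite"
  by (simp add: vec_eq_iff matrix_matrix_mult_def)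

text \<open>The usual uniqueness argument \<open>Q = Q ** (M ** R) = (Q ** M) ** R = R\<close>, with
  \<open>id_on \<sigma>\<close> as the unit of the matrices supported on
  \<open>\<sigma> \<times> \<sigma>\<close>.\<close>

lemma inv_on_eqI:
  fixes M R :: "real^'i^'i::finite"
  assumes supp: "\<forall>i j. i \<notin> \<sigma> \<or> j \<notin> \<sigma> \<longrightarrow> R $ i $ j = 0"
    and MR: "M ** R = id_on \<sigma>" and RM: "R ** M = id_on \<sigma>"
  shows "inv_on \<sigma> M = R"
  unfolding inv_on_def
proof (rule the_equality)
  fix Q assume Q: "(\<forall>i j. i \<notin> \<sigma> \<or> j \<notin> \<sigma> \<longrightarrow> Q $ i $ j = 0) \<and> M ** Q = id_on \<sigma> \<and> Q ** M = id_on \<sigma>"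
  have "id_on \<sigma> ** R = R"
    using supp by (simp add: id_on_def sel_matrix_mult vec_eq_iff)
  moreover have "Q ** id_on \<sigma> = Q"
  proof -
    have "(Q ** id_on \<sigma>) $ i $ j = Q $ i $ j" for i j
    proof -
      have idn: "id_on \<sigma> $ k $ j = (if k = j \<and> j \<in> \<sigma> then 1 else 0)" for k
        by (simp add: id_on_def mat_def)
      have "(Q ** id_on \<sigma>) $ i $ j = (if j \<in> \<sigma> then Q $ i $ j else 0)"
        by (simp add: matrix_matrix_mult_def idn if_distrib[where f = "\<lambda>x. _ * x"] cong: if_cong)
      then show ?thesis using Q by simp
    qed
    then show ?thesis by (simp add: vec_eq_iff)
  qed
  ultimately show "Q = R" using Q MR by (metis matrix_mul_assoc)
qed (use assms in simp)

text \<open>Adding the identity on the complement of \<open>\<sigma>\<close> turns an injective matrix supported on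
  \<open>\<sigma> \<times> \<sigma>\<close> into an invertible one.\<close>

lemma inv_on_properties:
  fixes M :: "real^'i^'i::finite"
  assumes M1: "\<And>z. sel \<sigma> (M *v z) = M *v z" and M2: "\<And>z. M *v sel \<sigma> z = M *v z"
    and inj: "\<And>z. sel \<sigma> z = z \<Longrightarrow> M *v z = 0 \<Longrightarrow> z = 0"
  shows "sel \<sigma> (inv_on \<sigma> M *v z) = inv_on \<sigma> M *v z"
    and "M *v (inv_on \<sigma> M *v z) = sel \<sigma> z"
    and "inv_on \<sigma> M *v (M *v z) = sel \<sigma> z"
proof -
  let ?J = "id_on (- \<sigma>) :: real^'i^'i"
  define Q where "Q = M + ?J"
  have Qz: "Q *v z = M *v z + sel (- \<sigma>) z" for z
    by (simp add: Q_def matrix_vector_mult_add_rdistrib)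
  have selQ: "sel \<sigma> (Q *v z) = M *v z" "sel (- \<sigma>) (Q *v z) = sel (- \<sigma>) z" for z
    using M1[of z] by (auto simp: Qz vec_eq_iff) metis+
  have "z = 0" if "Q *v z = 0" for z
  proof (rule inj)
    show "M *v z = 0" using selQ(1)[of z] that by simp
    have "sel (- \<sigma>) z = 0" using selQ(2)[of z] that by simp
    then show "sel \<sigma> z = z" using sel_add_compl[of \<sigma> z] by simp
  qed
  then obtain P where PQ: "P ** Q = mat 1" using matrix_left_invertible_ker by blast
  then have QP: "Q ** P = mat 1" by (simp add: matrix_left_right_inverse)
  have P1: "P *v (Q *v z) = z" "Q *v (P *v z) = z" for z
    using PQ QP by (simp_all add: matrix_vector_mul_assoc)
  \<comment> \<open>\<open>Q\<close> acts separately on \<open>\<sigma>\<close> and its complement,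
    so \<open>P\<close> is the inverse sought plus the identity on the complement.\<close>
  define R where "R = P - ?J"
  have R: "R *v z = P *v z - sel (- \<sigma>) z" for z
    by (simp add: R_def matrix_vector_mult_diff_rdistrib)
  have MJ: "M *v sel (- \<sigma>) z = 0" for z
  proof -
    have "M *v sel (- \<sigma>) z = M *v sel \<sigma> (sel (- \<sigma>) z)" by (rule M2[symmetric])
    also have "sel \<sigma> (sel (- \<sigma>) z) = 0" by (simp add: vec_eq_iff)
    finally show ?thesis by simp
  qed
  have PJ: "P *v sel (- \<sigma>) z = sel (- \<sigma>) z" for z
    using P1(1)[of "sel (- \<sigma>) z"] by (simp add: Qz MJ)
  have JP: "sel (- \<sigma>) (P *v z) = sel (- \<sigma>) z" for z
    using selQ(2)[of "P *v z"] by (simp add: P1)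
  have selR: "sel (- \<sigma>) (R *v z) = 0" for z
    by (simp add: R sel_diff JP)
  have Rsel: "R *v sel (- \<sigma>) z = 0" for z by (simp add: R PJ)
  have MR: "M *v (R *v z) = sel \<sigma> z" for z
    using selQ(1)[of "P *v z"] by (simp add: P1 R MJ matrix_vector_mult_diff_distrib)
  have RM: "R *v (M *v z) = sel \<sigma> z" for z
  proof -
    have "R *v (M *v z) = R *v (Q *v z)"
      using Rsel[of z] by (simp add: Qz matrix_vector_right_distrib)
    also have "\<dots> = z - sel (- \<sigma>) z" by (simp add: R P1 selQ)
    finally show ?thesis by (metis add_diff_cancel_right' sel_add_compl)
  qed
  have supp: "R $ i $ j = 0" if "i \<notin> \<sigma> \<or> j \<notin> \<sigma>" for i j
  proof -
    have R1: "R $ i $ j = (R *v axis j 1) $ i" by (simp add: matrix_vector_mult_basis column_def)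
    show ?thesis
    proof (cases "i \<in> \<sigma>")
      case True
      then have "sel (- \<sigma>) (axis j 1) = axis j (1 :: real)" using that by (auto simp: vec_eq_iff axis_def)
      then show ?thesis using Rsel[of "axis j 1"] R1 by simp
    next
      case False
      then show ?thesis using selR[of "axis j 1"] R1 by (simp add: vec_eq_iff) (metis)
    qed
  qed
  have "M ** R = id_on \<sigma>" "R ** M = id_on \<sigma>"
    by (simp_all add: matrix_eq matrix_vector_mul_assoc[symmetric] MR RM)
  with supp have eq: "inv_on \<sigma> M = R" by (intro inv_on_eqI) auto
  show "sel \<sigma> (inv_on \<sigma> M *v z) = inv_on \<sigma> M *v z"
    using sel_add_compl[of \<sigma> "R *v z"] selR[of z] by (simp add: eq)
  show "M *v (inv_on \<sigma> M *v z) = sel \<sigma> z" "inv_on \<sigma> M *v (M *v z) = sel \<sigma> z"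
    by (simp_all add: eq MR RM)
qed

subsection \<open>Linear functions on ellipsoids\<close>

text \<open>The worst \<open>d\<close> on the left is a multiple of \<open>p\<close>; on the right, \<open>b\<close> is chosen so that
  \<open>\<theta>\<close> times the quadratic form is the square \<open>\<parallel>sqrt \<rho> * t * E p + \<theta> * E d\<parallel>\<^sup>2\<close>.\<close>

lemma positive_on_ellipsoid_iff:
  fixes E :: "'a::real_vector \<Rightarrow> 'b::real_inner"
  assumes E: "linear E" and \<rho>: "\<rho> \<ge> 0"
  shows "(\<forall>d. (norm (E d))\<^sup>2 \<le> \<rho> \<longrightarrow> 0 < \<theta> + E p \<bullet> E d) \<longleftrightarrow>
    (\<exists>b>0. \<forall>t d. 0 \<le> (\<theta> - b) * t\<^sup>2 + 2 * t * (sqrt \<rho> * (E p \<bullet> E d)) + \<theta> * (norm (E d))\<^sup>2)"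
    (is "?L \<longleftrightarrow> ?R")
proof
  assume L: ?L
  define k where "k = norm (E p)"
  have E0: "E 0 = 0" using E by (rule linear_0)
  have \<theta>: "sqrt \<rho> * k < \<theta>"
  proof (cases "k = 0")
    case True
    then show ?thesis using L[rule_format, of 0] E0 \<rho> by simp
  next
    case False
    \<comment> \<open>The scaling puts \<open>E d\<close> on the boundary,
      \<open>(norm (E d))\<^sup>2 = \<rho>\<close>, and opposite to \<open>E p\<close>, where
      Cauchy-Schwarz is an equality.\<close>
    have "E ((- sqrt \<rho> / k) *\<^sub>R p) = (- sqrt \<rho> / k) *\<^sub>R E p" using E by (rule linear_cmul)
    then show ?thesis
      using L[rule_format, of "(- sqrt \<rho> / k) *\<^sub>R p"] False \<rho>
      by (simp add: k_def power_divide power_mult_distrib dot_square_norm power2_eq_square)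
  qed
  have "0 \<le> sqrt \<rho> * k" using \<rho> by (simp add: k_def)
  with \<theta> have \<theta>0: "\<theta> > 0" by linarith
  have "(sqrt \<rho> * k)\<^sup>2 < \<theta>\<^sup>2" using \<theta> \<open>0 \<le> sqrt \<rho> * k\<close> by (intro power_strict_mono) auto
  then have lt: "\<rho> * k\<^sup>2 < \<theta>\<^sup>2" using \<rho> by (simp add: power_mult_distrib)
  show ?R
  proof (intro exI[of _ "\<theta> - \<rho> * k\<^sup>2 / \<theta>"] conjI allI)
    show "0 < \<theta> - \<rho> * k\<^sup>2 / \<theta>" using lt \<theta>0 by (simp add: field_simps power2_eq_square)
    fix t d
    have "\<theta> * ((\<theta> - (\<theta> - \<rho> * k\<^sup>2 / \<theta>)) * t\<^sup>2 + 2 * t * (sqrt \<rho> * (E p \<bullet> E d)) + \<theta> * (norm (E d))\<^sup>2)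
        = (norm ((sqrt \<rho> * t) *\<^sub>R E p + \<theta> *\<^sub>R E d))\<^sup>2"
    proof -
      have "(norm (x + y))\<^sup>2 = (norm x)\<^sup>2 + 2 * (x \<bullet> y) + (norm y)\<^sup>2" for x y :: 'b
        by (simp add: power2_norm_eq_inner inner_add_left inner_add_right inner_commute)
      then show ?thesis
        using \<theta>0 \<rho> by (simp add: k_def power_mult_distrib algebra_simps power2_eq_square inner_commute[of "E d"])
    qed
    then show "0 \<le> (\<theta> - (\<theta> - \<rho> * k\<^sup>2 / \<theta>)) * t\<^sup>2 + 2 * t * (sqrt \<rho> * (E p \<bullet> E d)) + \<theta> * (norm (E d))\<^sup>2"
      using \<theta>0 by (metis zero_le_mult_iff zero_le_power2 not_less)
  qed
next
  assume ?R
  then obtain b where b: "b > 0"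
    and q: "\<And>t d. 0 \<le> (\<theta> - b) * t\<^sup>2 + 2 * t * (sqrt \<rho> * (E p \<bullet> E d)) + \<theta> * (norm (E d))\<^sup>2" by blast
  have \<theta>: "b \<le> \<theta>" using q[of 1 0] linear_0[OF E] by simp
  show ?L
  proof (intro allI impI)
    fix d assume d: "(norm (E d))\<^sup>2 \<le> \<rho>"
    show "0 < \<theta> + E p \<bullet> E d"
    proof (cases "\<rho> = 0")
      case True
      then show ?thesis using d b \<theta> by simp
    next
      case False
      \<comment> \<open>At \<open>t = sqrt \<rho>\<close> every term is bounded by a multiple of
        \<open>\<rho>\<close>; cancelling \<open>\<rho>\<close> leaves
        \<open>b \<le> 2 * (\<theta> + E p \<bullet> E d)\<close>.\<close>
      have "\<theta> * (norm (E d))\<^sup>2 \<le> \<theta> * \<rho>" using d b \<theta> by (intro mult_left_mono) auto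
      moreover have sq: "sqrt \<rho> * (sqrt \<rho> * r) = \<rho> * r" for r
        using \<rho> by (simp add: mult.assoc[symmetric])
      ultimately have "0 \<le> \<rho> * (2 * \<theta> - b + 2 * (E p \<bullet> E d))"
        using q[of "sqrt \<rho>" d] \<rho> by (simp add: algebra_simps sq)
      then have "0 \<le> 2 * \<theta> - b + 2 * (E p \<bullet> E d)" using False \<rho> by (simp add: zero_le_mult_iff)
      then show ?thesis using b by linarith
    qed
  qed
qed

section \<open>Bordered matrices, the blocks of \<open>N\<close> and the matrix inequality\<close>

lemma pos_semidef_bordered_iff:
  fixes M :: "real^'i^'i::finite"
  assumes "transpose M = M"
  shows "pos_semidef (block (mat a :: real^1^1) (rowvector r) (columnvector r) M) \<longleftrightarrow>
    (\<forall>t d. 0 \<le> a * t\<^sup>2 + 2 * t * (r \<bullet> d) + d \<bullet> (M *v d))"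
proof -
  have quad: "vcat x d \<bullet> (block (mat a) (rowvector r) (columnvector r) M *v vcat x d)
      = a * (x $ 1)\<^sup>2 + 2 * x $ 1 * (r \<bullet> d) + d \<bullet> (M *v d)" for x :: "real^1" and d
  proof -
    have "x \<bullet> (mat a *v x) = a * (x $ 1)\<^sup>2"
      by (simp add: inner_vec_def matrix_vector_mult_def mat_def power2_eq_square)
    moreover have "x \<bullet> (rowvector r *v d) = x $ 1 * (r \<bullet> d)"
      by (simp add: inner_vec_def matrix_vector_mult_def rowvector_def)
    moreover have "d \<bullet> (columnvector r *v x) = x $ 1 * (r \<bullet> d)"
      by (simp add: inner_vec_def matrix_vector_mult_def columnvector_def sum_distrib_left algebra_simps)
    ultimately show ?thesis
      by (simp add: block_mult_vcat inner_vcat inner_add_right)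
  qed
  have sym: "transpose (block (mat a :: real^1^1) (rowvector r) (columnvector r) M)
      = block (mat a) (rowvector r) (columnvector r) M"
    using assms by (simp add: transpose_block block_eq_iff)
      (simp add: transpose_def rowvector_def columnvector_def)
  show ?thesis
  proof
    assume *: "pos_semidef (block (mat a :: real^1^1) (rowvector r) (columnvector r) M)"
    show "\<forall>t d. 0 \<le> a * t\<^sup>2 + 2 * t * (r \<bullet> d) + d \<bullet> (M *v d)"
    proof (intro allI)
      fix t d
      show "0 \<le> a * t\<^sup>2 + 2 * t * (r \<bullet> d) + d \<bullet> (M *v d)"
        using * quad[of "vec t" d] unfolding pos_semidef_def by (metis vec_component)
    qed
  next
    assume *: "\<forall>t d. 0 \<le> a * t\<^sup>2 + 2 * t * (r \<bullet> d) + d \<bullet> (M *v d)"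
    show "pos_semidef (block (mat a :: real^1^1) (rowvector r) (columnvector r) M)"
      unfolding pos_semidef_def
    proof (intro conjI allI)
      fix z :: "real^(1 + 'i)"
      obtain x d where "z = vcat x d" by (rule vcat_cases)
      then show "0 \<le> z \<bullet> (block (mat a) (rowvector r) (columnvector r) M *v z)"
        using * by (simp add: quad)
    qed (rule sym)
  qed
qed

text \<open>The quadratic form of \<open>N\<close> at \<open>vcat (vec 1) z\<close> is
  \<open>\<Phi> - (norm (c - E *v z))\<^sup>2\<close>, where \<open>c\<close> is what the known
  parameters leave unexplained and \<open>E\<close> is the regressor of the unknown ones. The blocks
  are the coefficients of this square.\<close>

lemma N_matrix_blocks:
  fixes D :: "real^('n::finite \<times> 't::finite)^'i::finite" and s :: "'i set"
  defines "E \<equiv> transpose (sel (- s) D)"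
  assumes c: "c = vectorize (transpose Xd) - transpose (sel s D) *v sel s v"
  shows "blk11 (N_matrix \<Phi> Xd D s v) = \<Phi> - c \<bullet> c"
    and "blk12 (N_matrix \<Phi> Xd D s v) = transpose E *v c"
    and "blk21 (N_matrix \<Phi> Xd D s v) = transpose E *v c"
    and "blk22 (N_matrix \<Phi> Xd D s v) = - (transpose E ** E)"
proof -
  have "N_matrix \<Phi> Xd D s v = transpose (block (mat 1) 0 (columnvector c) (- E)) **
      noise_matrix \<Phi> ** block (mat 1) 0 (columnvector c) (- E)"
    by (simp add: N_matrix_def c E_def Let_def)
  also have "\<dots> = block (mat \<Phi> - rowvector c ** columnvector c) (rowvector c ** E)
      (transpose E ** columnvector c) (- (transpose E ** E))"
    by (simp add: noise_matrix_def transpose_block block_mult_block block_eq_iff)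
      (simp add: vec_eq_iff matrix_matrix_mult_def transpose_def rowvector_def columnvector_def mat_def
        sum_negf if_distrib cong: if_cong)
  finally have N: "N_matrix \<Phi> Xd D s v = \<dots>" .
  show "blk11 (N_matrix \<Phi> Xd D s v) = \<Phi> - c \<bullet> c"
    "blk12 (N_matrix \<Phi> Xd D s v) = transpose E *v c"
    "blk21 (N_matrix \<Phi> Xd D s v) = transpose E *v c"
    "blk22 (N_matrix \<Phi> Xd D s v) = - (transpose E ** E)"
    unfolding N blk11_def blk12_def blk21_def blk22_def block_def
    by (simp_all add: vec_eq_iff matrix_matrix_mult_def matrix_vector_mult_def transpose_def rowvector_def
        columnvector_def mat_def inner_vec_def mult.commute)
qed

text \<open>In the proof, \<open>z0\<close> is the least squares estimate, the centre of the ellipsoid.\<close>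

lemma LMI_matrix_pos_semidef_iff:
  fixes D :: "real^('n::finite \<times> 't::finite)^'i::finite" and v l :: "real^'i"
  assumes inj: "\<And>z. transpose D *v z = 0 \<Longrightarrow> z = 0"
    and feasible: "(norm (vectorize (transpose Xd) - transpose D *v v))\<^sup>2 \<le> \<Phi>"
  shows "(\<exists>b>0. pos_semidef (LMI_matrix (N_matrix \<Phi> Xd D s v) s v l b)) \<longleftrightarrow>
    (\<forall>q. sel s q = sel s v \<and> (norm (vectorize (transpose Xd) - transpose D *v q))\<^sup>2 \<le> \<Phi> \<longrightarrow> 0 < l \<bullet> q)"
proof -
  note transpose_matrix_vector [simp del]
  define y where "y = vectorize (transpose Xd)"
  define E where "E = transpose (sel (- s) D)"
  define c where "c = y - transpose (sel s D) *v sel s v"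
  define N where "N = N_matrix \<Phi> Xd D s v"
  note N = N_matrix_blocks[OF c_def[unfolded y_def], of \<Phi>, folded E_def N_def]
  define R where "R = inv_on (- s) (blk22 N)"
  have E: "E *v z = transpose D *v sel (- s) z" for z
    by (simp add: E_def transpose_sel_mult_vec)
  have Esel: "E *v sel (- s) z = E *v z" for z by (simp add: E)
  have adj: "(transpose E *v a) \<bullet> z = a \<bullet> (E *v z)" for a z
    by (simp add: transpose_matrix_vector dot_lmul_matrix)
  have selE: "sel (- s) (transpose E *v a) = transpose E *v a" for a
    by (simp add: E_def transpose_transpose vec_eq_iff matrix_vector_mult_def)
  have M: "blk22 N *v z = - (transpose E *v (E *v z))" for z
    by (simp add: N uminus_matrix_vector_mult matrix_vector_mul_assoc)
  have R: "sel (- s) (R *v z) = R *v z" "blk22 N *v (R *v z) = sel (- s) z" for z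
  proof -
    have *: "sel (- s) (blk22 N *v z) = blk22 N *v z" "blk22 N *v sel (- s) z = blk22 N *v z" for z
      by (simp_all add: M Esel sel_uminus selE)
    \<comment> \<open>\<open>blk22 N\<close> has the quadratic form
      \<open>- (norm (E *v z))\<^sup>2\<close>, negative definite on the unknown coordinates because
      \<open>transpose D\<close> is injective.\<close>
    have **: "z = 0" if "sel (- s) z = z" "blk22 N *v z = 0" for z
    proof -
      have "(transpose E *v (E *v z)) \<bullet> z = 0" using that(2) by (simp add: M)
      then have "E *v z = 0" by (simp add: adj)
      then show ?thesis using inj[of z] that(1) by (simp add: E)
    qed
    show "sel (- s) (R *v z) = R *v z" "blk22 N *v (R *v z) = sel (- s) z"
      unfolding R_def by (rule inv_on_properties[OF * **]; assumption)+
  qed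
  \<comment> \<open>The solution of the normal equations; the sign comes from
    \<open>blk22 N = - (transpose E ** E)\<close>.\<close>
  define z0 where "z0 = - (R *v (transpose E *v c))"
  have z0: "sel (- s) z0 = z0" "transpose E *v (E *v z0) = transpose E *v c"
  proof -
    show "sel (- s) z0 = z0" using R(1)[of "transpose E *v c"] by (simp add: z0_def sel_uminus)
    have "blk22 N *v z0 = - (transpose E *v c)"
      using R(2)[of "transpose E *v c"] by (simp add: z0_def matrix_vector_mult_uminus selE)
    then show "transpose E *v (E *v z0) = transpose E *v c" by (simp add: M)
  qed
  have orth: "(c - E *v z0) \<bullet> (E *v z) = 0" for z
    using z0(2) by (simp add: matrix_vector_mult_diff_distrib flip: adj)
  define \<rho> where "\<rho> = schur_compl (- s) N"
  \<comment> \<open>The Schur complement is the noise budget minus the squared least squares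
    residual.\<close>
  have \<rho>: "\<rho> = \<Phi> - (norm (c - E *v z0))\<^sup>2"
  proof -
    have "\<rho> = \<Phi> - c \<bullet> c + (transpose E *v c) \<bullet> z0"
      by (simp add: \<rho>_def schur_compl_def N(1-3) R_def[symmetric] z0_def)
    moreover have "(norm (c - E *v z0))\<^sup>2 = (c - E *v z0) \<bullet> c"
      using orth[of z0] by (simp add: power2_norm_eq_inner inner_diff_right)
    ultimately show ?thesis by (simp add: adj inner_diff_left inner_commute[of c "E *v z0"])
  qed
  \<comment> \<open>Pythagoras: \<open>q\<close> meets the noise bound if and only if
    \<open>(norm (E *v (q - z0)))\<^sup>2 \<le> \<rho>\<close>. \<open>E\<close> ignores the known
    entries of \<open>q\<close>.\<close>
  have res: "(norm (y - transpose D *v q))\<^sup>2 = \<Phi> - \<rho> + (norm (E *v (q - z0)))\<^sup>2"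
    if "sel s q = sel s v" for q
  proof -
    have "transpose D *v q = transpose D *v sel s q + transpose D *v sel (- s) q"
      by (simp add: sel_add_compl flip: matrix_vector_right_distrib)
    then have "y - transpose D *v q = (c - E *v z0) - E *v (q - z0)"
      using that by (simp add: c_def transpose_sel_mult_vec E[of q] matrix_vector_mult_diff_distrib)
    moreover have "(norm (a - w))\<^sup>2 = (norm a)\<^sup>2 + (norm w)\<^sup>2" if "a \<bullet> w = 0" for a w :: "real^('n \<times> 't)"
      using that inner_commute[of w a] by (simp add: power2_norm_eq_inner inner_diff_left inner_diff_right)
    ultimately show ?thesis using orth[of "q - z0"] by (simp add: \<rho>)
  qed
  have \<rho>0: "0 \<le> \<rho>"
    using res[OF refl] feasible zero_le_power2[of "norm (E *v (v - z0))"] unfolding y_def by linarith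
  define \<kappa> where "\<kappa> = sel s l \<bullet> sel s v"
  define \<theta> where "\<theta> = sel (- s) l \<bullet> z0 + \<kappa>"
  \<comment> \<open>\<open>p\<close> represents the unknown part of \<open>l\<close> in the form
    induced by \<open>E\<close>: \<open>transpose E *v (E *v p) = sel (- s) l\<close>.\<close>
  define p where "p = - (R *v sel (- s) l)"
  have p: "sel (- s) l \<bullet> d = (E *v p) \<bullet> (E *v d)" for d
  proof -
    have "blk22 N *v p = - sel (- s) l"
      using R(2)[of "sel (- s) l"] by (simp add: p_def matrix_vector_mult_uminus)
    then have "transpose E *v (E *v p) = sel (- s) l" by (simp add: M)
    then show ?thesis by (simp flip: adj)
  qed
  have LMI: "pos_semidef (LMI_matrix N s v l b) \<longleftrightarrow>
      (\<forall>t d. 0 \<le> (\<theta> - b) * t\<^sup>2 + 2 * t * (sqrt \<rho> * ((E *v p) \<bullet> (E *v d))) + \<theta> * (norm (E *v d))\<^sup>2)" for b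
  proof -
    \<comment> \<open>The scalar in the lower right block is therefore \<open>- \<theta>\<close>,
      which makes that block \<open>\<theta>\<close> times the Gram matrix of
      \<open>E\<close>.\<close>
    have \<theta>: "sel (- s) l \<bullet> (inv_on (- s) (blk22 N) *v blk21 N) = \<kappa> - \<theta>"
      by (simp add: \<theta>_def z0_def N(3) R_def[symmetric])
    have sym: "transpose (- \<theta> *\<^sub>R blk22 N) = - \<theta> *\<^sub>R blk22 N"
      by (simp add: N vec_eq_iff transpose_def matrix_matrix_mult_def mult.commute)
    have quad: "d \<bullet> ((- \<theta> *\<^sub>R blk22 N) *v d) = \<theta> * (norm (E *v d))\<^sup>2" for d
    proof -
      have "d \<bullet> ((- \<theta> *\<^sub>R blk22 N) *v d) = \<theta> * ((transpose E *v (E *v d)) \<bullet> d)"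
        by (simp add: uminus_matrix_vector_mult scaleR_matrix_vector_assoc[symmetric] M inner_commute)
      then show ?thesis by (simp add: adj power2_norm_eq_inner)
    qed
    have "LMI_matrix N s v l b = block (mat (\<theta> - b)) (rowvector (sqrt \<rho> *\<^sub>R sel (- s) l))
        (columnvector (sqrt \<rho> *\<^sub>R sel (- s) l)) (- \<theta> *\<^sub>R blk22 N)"
      by (simp add: LMI_matrix_def Let_def \<theta> \<kappa>_def[symmetric] \<rho>_def[symmetric])
    then show ?thesis
      using pos_semidef_bordered_iff[OF sym, of "\<theta> - b" "sqrt \<rho> *\<^sub>R sel (- s) l"] quad p by simp
  qed
  have split: "l \<bullet> q = \<theta> + (E *v p) \<bullet> (E *v (q - z0))" if "sel s q = sel s v" for q
  proof -
    have "l \<bullet> q = sel s l \<bullet> sel s q + sel (- s) l \<bullet> q"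
      by (simp add: inner_sel inner_add_right[symmetric] sel_add_compl)
    then show ?thesis by (simp add: that \<theta>_def \<kappa>_def inner_diff_right flip: p)
  qed
  have "(\<exists>b>0. pos_semidef (LMI_matrix N s v l b)) \<longleftrightarrow>
      (\<forall>d. (norm (E *v d))\<^sup>2 \<le> \<rho> \<longrightarrow> 0 < \<theta> + (E *v p) \<bullet> (E *v d))"
    unfolding LMI by (rule positive_on_ellipsoid_iff[symmetric, OF _ \<rho>0]) simp
  also have "\<dots> \<longleftrightarrow> (\<forall>q. sel s q = sel s v \<and> (norm (y - transpose D *v q))\<^sup>2 \<le> \<Phi> \<longrightarrow> 0 < l \<bullet> q)"
  proof (intro iffI allI impI; (elim conjE)?)
    fix q assume *: "\<forall>d. (norm (E *v d))\<^sup>2 \<le> \<rho> \<longrightarrow> 0 < \<theta> + (E *v p) \<bullet> (E *v d)"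
      and q: "sel s q = sel s v" "(norm (y - transpose D *v q))\<^sup>2 \<le> \<Phi>"
    show "0 < l \<bullet> q" using *[rule_format, of "q - z0"] q(2) by (simp add: res[OF q(1)] split[OF q(1)])
  next
    fix d assume *: "\<forall>q. sel s q = sel s v \<and> (norm (y - transpose D *v q))\<^sup>2 \<le> \<Phi> \<longrightarrow> 0 < l \<bullet> q"
      and d: "(norm (E *v d))\<^sup>2 \<le> \<rho>"
    \<comment> \<open>The known entries of \<open>d\<close> are replaced by those of
      \<open>v\<close>; \<open>E\<close> sees neither, so the displacement from \<open>z0\<close>
      still has image \<open>E *v d\<close>.\<close>
    define q where "q = sel s v + z0 + sel (- s) d"
    have q: "sel s q = sel s v"
      using z0(1) by (auto simp: q_def vec_eq_iff) (metis)
    have "sel (- s) (sel s v) = 0" by (simp add: vec_eq_iff)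
    then have "E *v sel s v = 0" by (simp add: E)
    then have Ed: "E *v (q - z0) = E *v d"
      by (simp add: q_def Esel matrix_vector_right_distrib matrix_vector_mult_diff_distrib)
    have "0 < l \<bullet> q" using *[rule_format, of q] d by (simp add: q res[OF q] Ed)
    then show "0 < \<theta> + (E *v p) \<bullet> (E *v d)" by (simp add: split[OF q] Ed)
  qed
  finally show ?thesis unfolding N_def y_def .
qed

subsection \<open>Parametrization of the consistent systems\<close>

lemma vectorize_diff: "vectorize (M - M') = vectorize M - vectorize (M' :: real^'c::finite^'r::finite)"
  by (simp add: vec_eq_iff vectorize_def)

lemma transpose_diff: "transpose (M - M') = transpose M - transpose (M' :: real^'c::finite^'r::finite)"
  by (simp add: vec_eq_iff transpose_def)

text \<open>The identity \<open>vec(X Y Z) = kron(Z^T, X) vec(Y)\<close> with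
  \<open>X = P^T\<close>, \<open>Y = A^T\<close> and \<open>Z\<close> the identity.\<close>

lemma transpose_kron_mult_vectorize:
  fixes A :: "real^'f::finite^'n::finite" and P :: "real^'t::finite^'f"
  shows "transpose (kron (mat 1) P) *v vectorize (transpose A) = vectorize (transpose (A ** P))"
  by (simp add: vec_eq_iff matrix_vector_mult_def matrix_matrix_mult_def transpose_def vectorize_def kron_def
      mat_def sum_UNIV_prod if_distrib[where f = "\<lambda>x. _ * x"] sum.swap[of _ UNIV "UNIV :: 'n set"] mult.commute
      del: transpose_matrix_vector cong: if_cong)

lemma data_matrix_mult_param_vec:
  "transpose (data_matrix F G X U) *v param_vec A B
    = vectorize (transpose (A ** F_data F X + B ** G_data G X ** U))"
proof -
  have "transpose (data_matrix F G X U) *v param_vec A B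
      = vectorize (transpose (A ** F_data F X)) + vectorize (transpose (B ** (G_data G X ** U)))"
    unfolding data_matrix_def param_vec_def transpose_vcat_mult_vec transpose_kron_mult_vectorize ..
  then show ?thesis by (simp add: vec_eq_iff vectorize_def transpose_def matrix_mul_assoc)
qed

lemma param_vec_surj:
  obtains A :: "real^'f::finite^'n::finite" and B :: "real^'g::finite^'n" where "q = param_vec A B"
  by (rule that[of "\<chi> i j. q $ Inl (i, j)" "\<chi> i j. q $ Inr (i, j)"])
    (simp add: vec_eq_iff_Plus param_vec_def vectorize_def transpose_def)

lemma noise_bound_iff: "noise_bound \<Phi> W \<longleftrightarrow> (norm (vectorize (transpose W)))\<^sup>2 \<le> \<Phi>"
proof -
  let ?w = "vectorize (transpose W)"
  have "vec 1 \<bullet> (mat \<Phi> *v (vec 1 :: real^1)) = \<Phi>"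
    by (simp add: inner_vec_def matrix_vector_mult_def mat_def)
  then show ?thesis
    by (simp add: noise_bound_def noise_matrix_def block_mult_vcat inner_vcat Let_def
        uminus_matrix_vector_mult power2_norm_eq_inner)
qed

text \<open>The parameters determine the noise as the residual of the data equation, so the
  existential over \<open>W\<close> collapses to one bound.\<close>

lemma Sigma_d_iff:
  "(A, B) \<in> Sigma_d F G Xd X U \<Phi> \<longleftrightarrow>
    (norm (vectorize (transpose Xd) - transpose (data_matrix F G X U) *v param_vec A B))\<^sup>2 \<le> \<Phi>"
proof -
  let ?W = "Xd - (A ** F_data F X + B ** G_data G X ** U)"
  have "Xd = A ** F_data F X + B ** G_data G X ** U + W \<longleftrightarrow> W = ?W" for W
    by (auto simp: algebra_simps)
  then have "(A, B) \<in> Sigma_d F G Xd X U \<Phi> \<longleftrightarrow> noise_bound \<Phi> ?W"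
    by (simp add: Sigma_d_def)
  then show ?thesis
    by (simp add: noise_bound_iff data_matrix_mult_param_vec transpose_diff vectorize_diff del: transpose_matrix_vector)
qed

lemma Sigma_pk_iff:
  "(A, B) \<in> Sigma_pk A0 B0 S \<longleftrightarrow> sel (known_idx S) (param_vec A B) = sel (known_idx S) (param_vec A0 B0)"
proof
  assume pk: "(A, B) \<in> Sigma_pk A0 B0 S"
  then show "sel (known_idx S) (param_vec A B) = sel (known_idx S) (param_vec A0 B0)"
    by (fastforce simp: vec_eq_iff_Plus Sigma_pk_def known_idx_def param_vec_def vectorize_def transpose_def)
next
  assume eq: "sel (known_idx S) (param_vec A B) = sel (known_idx S) (param_vec A0 B0)"
  have "hcat A B $ i $ j = hcat A0 B0 $ i $ j" if "(i, j) \<in> S" for i j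
  proof (cases j)
    case (Inl a)
    then have "Inl (i, a) \<in> known_idx S" using that by (simp add: known_idx_def)
    then have "param_vec A B $ Inl (i, a) = param_vec A0 B0 $ Inl (i, a)"
      using eq by (metis sel_nth)
    then show ?thesis using Inl by (simp add: param_vec_def vectorize_def transpose_def)
  next
    case (Inr a)
    then have "Inr (i, a) \<in> known_idx S" using that by (simp add: known_idx_def)
    then have "param_vec A B $ Inr (i, a) = param_vec A0 B0 $ Inr (i, a)"
      using eq by (metis sel_nth)
    then show ?thesis using Inr by (simp add: param_vec_def vectorize_def transpose_def)
  qed
  then show "(A, B) \<in> Sigma_pk A0 B0 S" by (auto simp: Sigma_pk_def)
qed

text \<open>The transposed data matrix acts on each row of \<open>[A B]\<close> separately, by the
  transpose of the stacked data, which full row rank makes injective.\<close>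

lemma data_matrix_injective:
  fixes F :: "real^'n::finite \<Rightarrow> real^'f::finite" and G :: "real^'n \<Rightarrow> real^'m::finite^'g::finite"
    and X :: "real^'t::finite^'n"
  assumes rank: "rank (vcat (F_data F X) (G_data G X ** U)) = CARD('f + 'g)"
    and z: "transpose (data_matrix F G X U) *v z = 0"
  shows "z = 0"
proof -
  let ?P = "vcat (F_data F X) (G_data G X ** U)"
  obtain A :: "real^'f^'n" and B :: "real^'g^'n" where zAB: "z = param_vec A B" by (rule param_vec_surj)
  have 0: "A ** F_data F X + B ** G_data G X ** U = 0"
    using z unfolding zAB data_matrix_mult_param_vec by (simp add: vec_eq_iff vectorize_def transpose_def)
  have inj: "inj ((*v) (transpose ?P))"
    using rank by (simp add: full_rank_injective[symmetric] rank_transpose del: transpose_matrix_vector)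
  have "vcat (A $ i) (B $ i) = 0" for i
  proof -
    have "transpose ?P *v vcat (A $ i) (B $ i) = (A ** F_data F X + B ** (G_data G X ** U)) $ i"
      unfolding transpose_vcat_mult_vec
      by (simp add: vec_eq_iff matrix_vector_mult_def matrix_matrix_mult_def transpose_def mult.commute
          del: transpose_matrix_vector)
    also have "\<dots> = transpose ?P *v 0" using 0 by (simp add: matrix_mul_assoc)
    finally show ?thesis using inj by (blast dest: injD)
  qed
  then show ?thesis
    by (simp add: zAB vec_eq_iff_Plus param_vec_def vectorize_def transpose_def)
qed

text \<open>Each Kronecker block pairs with its vectorized parameter matrix to the gradient times
  that matrix's term of the closed loop. The minus signs in \<open>L_vec\<close> turn decrease of
  \<open>V\<close> into positivity of a linear function on the ellipsoid.\<close>

lemma L_vec_inner_param_vec: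
  "L_vec F G K V x \<bullet> param_vec A B = - (gradient V x \<bullet> closed_loop F G K A B x)"
proof -
  let ?g = "\<chi> p :: 'a \<times> 1. gradient V x $ fst p"
  have kron: "(kron (mat 1) (columnvector y) *v ?g) \<bullet> vectorize (transpose M) = gradient V x \<bullet> (M *v y)"
    for y :: "real^'k::finite" and M :: "real^'k^'a"
    by (simp add: inner_vec_def matrix_vector_mult_def kron_def columnvector_def mat_def vectorize_def transpose_def
        sum_UNIV_prod sum_distrib_left if_distrib[where f = "\<lambda>x. _ * x"] mult_ac cong: if_cong)
  show ?thesis
    unfolding L_vec_def closed_loop_def param_vec_def vcat_mult_vec inner_vcat uminus_matrix_vector_mult
    by (simp add: kron inner_add_right)
qed

lemma continuous_on_closed_loop:
  fixes F :: "real^'n::finite \<Rightarrow> real^'f::finite" and G :: "real^'n \<Rightarrow> real^'m::finite^'g::finite"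
  assumes "\<And>i. real_polynomial_function (\<lambda>y. F y $ i)" "\<And>i j. real_polynomial_function (\<lambda>y. G y $ i $ j)"
    and "continuous_on UNIV K"
  shows "continuous_on UNIV (closed_loop F G K A B)"
proof -
  have cont: "continuous_on UNIV p" if "real_polynomial_function p" for p :: "real^'n \<Rightarrow> real"
    using continuous_real_polymonial_function[OF that] by (simp add: continuous_on_eq_continuous_at)
  have K: "continuous_on UNIV (\<lambda>y. K y $ i)" for i
    using assms(3) by (intro continuous_intros)
  have "closed_loop F G K A B = (\<lambda>y. \<chi> i. (\<Sum>j\<in>UNIV. A $ i $ j * F y $ j)
      + (\<Sum>j\<in>UNIV. B $ i $ j * (\<Sum>k\<in>UNIV. G y $ j $ k * K y $ k)))"
    by (simp add: fun_eq_iff closed_loop_def vec_eq_iff matrix_vector_mult_def)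
  then show ?thesis
    by (auto intro!: continuous_intros cont[OF assms(1)] cont[OF assms(2)] K)
qed

theorem theorem3:
  fixes F :: "real^'n::finite \<Rightarrow> real^'f::finite"
    and G :: "real^'n \<Rightarrow> real^'m::finite^'g::finite"
    and A_true :: "real^'f^'n" and B_true :: "real^'g^'n"
    and \<tau> :: "'t::{finite,linorder} \<Rightarrow> real"
    and x xdot w :: "real \<Rightarrow> real^'n" and u :: "real \<Rightarrow> real^'m"
    and Xd X W :: "real^'t::{finite,linorder}^'n" and U :: "real^'t::{finite,linorder}^('t \<times> 'm)"
    and \<Phi>11 :: real
    and S :: "('n \<times> ('f + 'g)) set"
    and \<Sigma> :: "((real^'f^'n) \<times> (real^'g^'n)) set"
    and v :: "real^(('n \<times> 'f) + ('n \<times> 'g))"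
    and s :: "(('n \<times> 'f) + ('n \<times> 'g)) set"
    and N :: "real^(1 + (('n \<times> 'f) + ('n \<times> 'g)))^(1 + (('n \<times> 'f) + ('n \<times> 'g)))"
    and K :: "real^'n \<Rightarrow> real^'m"
  assumes F_poly: "\<And>i. real_polynomial_function (\<lambda>y. F y $ i)"
    and F_zero: "F 0 = 0"
    and G_poly: "\<And>i j. real_polynomial_function (\<lambda>y. G y $ i $ j)"
    and times: "strict_mono \<tau>"
    and deriv: "\<And>k. (x has_vector_derivative xdot (\<tau> k)) (at (\<tau> k))"
    and Xd: "Xd = samples xdot \<tau>" and X: "X = samples x \<tau>"
    and U: "U = input_data u \<tau>" and W: "W = samples w \<tau>"
    and data: "Xd = A_true ** F_data F X + B_true ** G_data G X ** U + W"
    and \<Phi>11: "\<Phi>11 \<ge> 0"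
    and noise: "noise_bound \<Phi>11 W"
    and full_row_rank: "rank (vcat (F_data F X) (G_data G X ** U)) = CARD('f + 'g)"
    and \<Sigma>: "\<Sigma> = Sigma_d F G Xd X U \<Phi>11 \<inter> Sigma_pk A_true B_true S"
    and v: "v = param_vec A_true B_true"
    and s: "s = known_idx S"
    and N: "N = N_matrix \<Phi>11 Xd (data_matrix F G X U) s v"
    and K_cont: "continuous_on UNIV K" and K_zero: "K 0 = 0"
  shows "(informative_for_stability F G \<Sigma> K \<longleftrightarrow> LMI_condition F G K N s v)
    \<and> (LMI_condition F G K N s v \<longrightarrow>
         (\<forall>(A, B)\<in>\<Sigma>. globally_asymptotically_stable (closed_loop F G K A B))
         \<and> informative_for_stabilization F G \<Sigma>)"
proof -
  define D where "D = data_matrix F G X U"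
  define consistent where "consistent q \<longleftrightarrow>
    sel s q = sel s v \<and> (norm (vectorize (transpose Xd) - transpose D *v q))\<^sup>2 \<le> \<Phi>11" for q
  have \<Sigma>_iff: "(A, B) \<in> \<Sigma> \<longleftrightarrow> consistent (param_vec A B)" for A B
    unfolding \<Sigma> Int_iff Sigma_d_iff Sigma_pk_iff consistent_def s v D_def by blast
  have inj: "z = 0" if "transpose D *v z = 0" for z
    using data_matrix_injective[OF full_row_rank] that unfolding D_def by blast
  have "(A_true, B_true) \<in> Sigma_d F G Xd X U \<Phi>11"
    using data noise by (auto simp: Sigma_d_def)
  then have feasible: "(norm (vectorize (transpose Xd) - transpose D *v v))\<^sup>2 \<le> \<Phi>11"
    unfolding Sigma_d_iff v D_def .
  have LMI: "(\<exists>b>0. pos_semidef (LMI_matrix N s v (L_vec F G K V y) b)) \<longleftrightarrow>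
      (\<forall>(A, B)\<in>\<Sigma>. gradient V y \<bullet> closed_loop F G K A B y < 0)" for V y
  proof -
    have "(\<exists>b>0. pos_semidef (LMI_matrix N s v (L_vec F G K V y) b)) \<longleftrightarrow>
        (\<forall>q. consistent q \<longrightarrow> 0 < L_vec F G K V y \<bullet> q)"
      unfolding N D_def[symmetric] consistent_def by (rule LMI_matrix_pos_semidef_iff[OF inj feasible])
    \<comment> \<open>Every \<open>q\<close> is the parameter vector of some pair, so the quantifier
      may range over systems.\<close>
    also have "\<dots> \<longleftrightarrow> (\<forall>A B. consistent (param_vec A B) \<longrightarrow> 0 < L_vec F G K V y \<bullet> param_vec A B)"
      by (metis param_vec_surj)
    finally show ?thesis by (auto simp: L_vec_inner_param_vec \<Sigma>_iff)
  qed
  have iff: "informative_for_stability F G \<Sigma> K \<longleftrightarrow> LMI_condition F G K N s v"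
  proof -
    have "(\<forall>(A, B)\<in>\<Sigma>. \<forall>y. y \<noteq> 0 \<longrightarrow> gradient V y \<bullet> closed_loop F G K A B y < 0) \<longleftrightarrow>
        (\<forall>y. y \<noteq> 0 \<longrightarrow> (\<exists>b>0. pos_semidef (LMI_matrix N s v (L_vec F G K V y) b)))" for V
      unfolding LMI by fast
    \<comment> \<open>\<open>\<beta>\<close> is subject to no regularity condition, so choosing
      \<open>b\<close> pointwise yields it.\<close>
    also have "\<dots> V \<longleftrightarrow> (\<exists>\<beta>. \<forall>y. y \<noteq> 0 \<longrightarrow> \<beta> y > 0 \<and> pos_semidef (LMI_matrix N s v (L_vec F G K V y) (\<beta> y)))" for V
      by metis
    finally show ?thesis
      unfolding informative_for_stability_def LMI_condition_def by blast
  qed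
  have "globally_asymptotically_stable (closed_loop F G K A B)"
    if inf: "informative_for_stability F G \<Sigma> K" and AB: "(A, B) \<in> \<Sigma>" for A B
  proof -
    obtain V where V: "V \<in> posdef_polys" "radially_unbounded V"
      and decr: "\<And>y. y \<noteq> 0 \<Longrightarrow> gradient V y \<bullet> closed_loop F G K A B y < 0"
      using inf AB unfolding informative_for_stability_def by blast
    interpret lyapunov V "gradient V" "closed_loop F G K A B"
    proof
      show "continuous_on UNIV (closed_loop F G K A B)"
        by (rule continuous_on_closed_loop[OF F_poly G_poly K_cont])
      show "closed_loop F G K A B 0 = 0" by (simp add: closed_loop_def F_zero K_zero)
    qed (use V decr real_polynomial_function_gradient in \<open>auto simp: posdef_polys_def\<close>)
    show ?thesis by (rule globally_asymptotically_stable)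
  qed
  moreover have "informative_for_stabilization F G \<Sigma>" if "informative_for_stability F G \<Sigma> K"
    using that K_cont K_zero unfolding informative_for_stability_def informative_for_stabilization_def by blast
  ultimately show ?thesis using iff by blast
qed

end
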